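(* Let $P$ be a poset, $\rho$ a height-difference function on $P$, and $\mathcal C$ a complete and cocomplete category. For each $r\ge0$, the $r$-latching functor $\mathsf L_r^\rho:\mathrm{Fun}(P,\mathcal C)\to\mathrm{Fun}(P,\mathcal C)$ is left adjoint to the $r$-matching functor $\mathsf R_r^\rho:\mathrm{Fun}(P,\mathcal C)\to\mathrm{Fun}(P,\mathcal C)$.
   Context: A poset $P$ is regarded as a category (a unique morphism $a\to b$ iff $a\le b$), and $\mathrm{Fun}(P,\mathcal C)$ is the category of functors $P\to\mathcal C$ and natural transformations. A height-difference function on $P$ is a function $\rho:\{(a,b)\in P\times P: a\le b\}\to[0,\infty]$ with $\rho(a,a)=0$ for all $a$ and $\rho(a,c)\ge\rho(a,b)+\rho(b,c)$ whenever $a\le b\le c$. For $a\in P$ and real $r\ge 0$ put $a^{\downarrow_r}=\{x\in P: x\le a,\ \rho(x,a)\ge r\}$ and $a^{\uparrow_r}=\{x\in P: x\ge a,\ \rho(a,x)\ge r\}$ (full subposets). The endofunctors $\mathsf L_r^\rho$ and $\mathsf R_r^\rho$ are defined by $(\mathsf L_r^\rho M)(a)=\operatorname{colim} M|_{a^{\downarrow_r}}$ and $(\mathsf R_r^\rho M)(a)=\lim M|_{a^{\uparrow_r}}$. For $a\le b$ the structure morphisms are the canonical maps $\operatorname{colim} M|_{a^{\downarrow_r}}\to\operatorname{colim} M|_{b^{\downarrow_r}}$ and $\lim M|_{a^{\uparrow_r}}\to\lim M|_{b^{\uparrow_r}}$ coming from $a^{\downarrow_r}\subseteq b^{\downarrow_r}$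 and $b^{\uparrow_r}\subseteq a^{\uparrow_r}$; on morphisms of $\mathrm{Fun}(P,\mathcal C)$ they act by the maps induced by the universal properties of colimits and limits. *)

theory Defs
  imports "HOL-Library.FuncSet" "HOL-Library.Extended_Nonnegative_Real"
begin

record ('o, 'm) cat =
  Obj :: "'o set"
  Arr :: "'m set"
  Dom :: "'m \<Rightarrow> 'o"
  Cod :: "'m \<Rightarrow> 'o"
  Ide :: "'o \<Rightarrow> 'm"
  Cmp :: "'m \<Rightarrow> 'm \<Rightarrow> 'm"  \<comment> \<open>\<open>Cmp C g f\<close> is \<open>g\<close> after \<open>f\<close>\<close>

definition hom_set :: "('o, 'm) cat \<Rightarrow> 'o \<Rightarrow> 'o \<Rightarrow> 'm set" where
  "hom_set C a b = {f \<in> Arr C. Dom C f = a \<and> Cod C f = b}"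

locale category =
  fixes C :: "('o, 'm) cat"
  assumes Dom_in: "f \<in> Arr C \<Longrightarrow> Dom C f \<in> Obj C"
    and Cod_in: "f \<in> Arr C \<Longrightarrow> Cod C f \<in> Obj C"
    and Ide_in: "a \<in> Obj C \<Longrightarrow> Ide C a \<in> hom_set C a a"
    and Cmp_in: "f \<in> hom_set C a b \<Longrightarrow> g \<in> hom_set C b c \<Longrightarrow> Cmp C g f \<in> hom_set C a c"
    and Cmp_Ide_right: "f \<in> hom_set C a b \<Longrightarrow> Cmp C f (Ide C a) = f"
    and Cmp_Ide_left: "f \<in> hom_set C a b \<Longrightarrow> Cmp C (Ide C b) f = f"
    and Cmp_assoc: "f \<in> hom_set C a b \<Longrightarrow> g \<in> hom_set C b c \<Longrightarrow> h \<in> hom_set C c d \<Longrightarrow>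
      Cmp C h (Cmp C g f) = Cmp C (Cmp C h g) f"

record ('o, 'm, 'p, 'q) func =
  FObj :: "'o \<Rightarrow> 'p"
  FArr :: "'m \<Rightarrow> 'q"

text \<open>Functors and transformations are required to be extensional (\<open>undefined\<close> off their domain),
  so that HOL equality coincides with equality of functors and of natural transformations.\<close>

definition is_functor ::
  "('o, 'm) cat \<Rightarrow> ('p, 'q) cat \<Rightarrow> ('o, 'm, 'p, 'q) func \<Rightarrow> bool" where
  "is_functor C D F \<longleftrightarrow>
     FObj F \<in> Obj C \<rightarrow>\<^sub>E Obj D \<and>
     FArr F \<in> Arr C \<rightarrow>\<^sub>E Arr D \<and>
     (\<forall>f\<in>Arr C. FArr F f \<in> hom_set D (FObj F (Dom C f)) (FObj F (Cod C f))) \<and>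
     (\<forall>a\<in>Obj C. FArr F (Ide C a) = Ide D (FObj F a)) \<and>
     (\<forall>f\<in>Arr C. \<forall>g\<in>Arr C. Cod C f = Dom C g \<longrightarrow>
        FArr F (Cmp C g f) = Cmp D (FArr F g) (FArr F f))"

definition is_nat_trans ::
  "('o, 'm) cat \<Rightarrow> ('p, 'q) cat \<Rightarrow> ('o, 'm, 'p, 'q) func \<Rightarrow> ('o, 'm, 'p, 'q) func \<Rightarrow>
     ('o \<Rightarrow> 'q) \<Rightarrow> bool" where
  "is_nat_trans C D F G \<alpha> \<longleftrightarrow>
     \<alpha> \<in> extensional (Obj C) \<and>
     (\<forall>a\<in>Obj C. \<alpha> a \<in> hom_set D (FObj F a) (FObj G a)) \<and>
     (\<forall>f\<in>Arr C. Cmp D (\<alpha> (Cod C f)) (FArr F f) = Cmp D (FArr G f) (\<alpha> (Dom C f)))"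

text \<open>An arrow of \<open>Fun(C, D)\<close> carries its source and target functor.\<close>

definition functor_cat ::
  "('o, 'm) cat \<Rightarrow> ('p, 'q) cat \<Rightarrow>
     (('o, 'm, 'p, 'q) func, ('o, 'm, 'p, 'q) func \<times> ('o \<Rightarrow> 'q) \<times> ('o, 'm, 'p, 'q) func) cat" where
  "functor_cat C D =
     \<lparr>Obj = {F. is_functor C D F},
      Arr = {(F, \<alpha>, G). is_functor C D F \<and> is_functor C D G \<and> is_nat_trans C D F G \<alpha>},
      Dom = (\<lambda>(F, \<alpha>, G). F),
      Cod = (\<lambda>(F, \<alpha>, G). G),
      Ide = (\<lambda>F. (F, \<lambda>a\<in>Obj C. Ide D (FObj F a), F)),
      Cmp = (\<lambda>(G', \<beta>, H) (F, \<alpha>, G). (F, \<lambda>a\<in>Obj C. Cmp D (\<beta> a) (\<alpha> a), H))\<rparr>"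

definition left_adjoint ::
  "('o, 'm) cat \<Rightarrow> ('p, 'q) cat \<Rightarrow> ('o, 'm, 'p, 'q) func \<Rightarrow> ('p, 'q, 'o, 'm) func \<Rightarrow> bool" where
  "left_adjoint C D F G \<longleftrightarrow>
     category C \<and> category D \<and> is_functor C D F \<and> is_functor D C G \<and>
     (\<exists>\<phi>. (\<forall>a\<in>Obj C. \<forall>b\<in>Obj D.
             bij_betw (\<phi> a b) (hom_set D (FObj F a) b) (hom_set C a (FObj G b))) \<and>
          (\<forall>a\<in>Obj C. \<forall>a'\<in>Obj C. \<forall>b\<in>Obj D. \<forall>b'\<in>Obj D.
             \<forall>f\<in>hom_set C a' a. \<forall>g\<in>hom_set D b b'. \<forall>h\<in>hom_set D (FObj F a) b.
               \<phi> a' b' (Cmp D g (Cmp D h (FArr F f))) =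
               Cmp C (FArr G g) (Cmp C (\<phi> a b h) f)))"

definition is_cone ::
  "('p, 'q) cat \<Rightarrow> ('j, 'k) cat \<Rightarrow> ('j, 'k, 'p, 'q) func \<Rightarrow> 'p \<Rightarrow> ('j \<Rightarrow> 'q) \<Rightarrow> bool" where
  "is_cone C J D x \<pi> \<longleftrightarrow>
     x \<in> Obj C \<and>
     (\<forall>j\<in>Obj J. \<pi> j \<in> hom_set C x (FObj D j)) \<and>
     (\<forall>u\<in>Arr J. Cmp C (FArr D u) (\<pi> (Dom J u)) = \<pi> (Cod J u))"

definition is_cocone ::
  "('p, 'q) cat \<Rightarrow> ('j, 'k) cat \<Rightarrow> ('j, 'k, 'p, 'q) func \<Rightarrow> 'p \<Rightarrow> ('j \<Rightarrow> 'q) \<Rightarrow> bool" where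
  "is_cocone C J D x \<iota> \<longleftrightarrow>
     x \<in> Obj C \<and>
     (\<forall>j\<in>Obj J. \<iota> j \<in> hom_set C (FObj D j) x) \<and>
     (\<forall>u\<in>Arr J. Cmp C (\<iota> (Cod J u)) (FArr D u) = \<iota> (Dom J u))"

definition is_limit ::
  "('p, 'q) cat \<Rightarrow> ('j, 'k) cat \<Rightarrow> ('j, 'k, 'p, 'q) func \<Rightarrow> 'p \<Rightarrow> ('j \<Rightarrow> 'q) \<Rightarrow> bool" where
  "is_limit C J D x \<pi> \<longleftrightarrow>
     is_cone C J D x \<pi> \<and>
     (\<forall>y \<sigma>. is_cone C J D y \<sigma> \<longrightarrow>
        (\<exists>!h. h \<in> hom_set C y x \<and> (\<forall>j\<in>Obj J. Cmp C (\<pi> j) h = \<sigma> j)))"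

definition is_colimit ::
  "('p, 'q) cat \<Rightarrow> ('j, 'k) cat \<Rightarrow> ('j, 'k, 'p, 'q) func \<Rightarrow> 'p \<Rightarrow> ('j \<Rightarrow> 'q) \<Rightarrow> bool" where
  "is_colimit C J D x \<iota> \<longleftrightarrow>
     is_cocone C J D x \<iota> \<and>
     (\<forall>y \<sigma>. is_cocone C J D y \<sigma> \<longrightarrow>
        (\<exists>!h. h \<in> hom_set C x y \<and> (\<forall>j\<in>Obj J. Cmp C h (\<iota> j) = \<sigma> j)))"

text \<open>HOL has no quantification over types, so ``small'' is relative to two types: an index category
  is small if its objects form a subset of \<open>'j\<close> and its arrows a subset of \<open>'k\<close>.\<close>

definition complete_cat :: "'j itself \<Rightarrow> 'k itself \<Rightarrow> ('p, 'q) cat \<Rightarrow> bool" where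
  "complete_cat TJ TK C \<longleftrightarrow>
     (\<forall>(J :: ('j, 'k) cat) D. category J \<and> is_functor J C D \<longrightarrow> (\<exists>x \<pi>. is_limit C J D x \<pi>))"

definition cocomplete_cat :: "'j itself \<Rightarrow> 'k itself \<Rightarrow> ('p, 'q) cat \<Rightarrow> bool" where
  "cocomplete_cat TJ TK C \<longleftrightarrow>
     (\<forall>(J :: ('j, 'k) cat) D. category J \<and> is_functor J C D \<longrightarrow> (\<exists>x \<iota>. is_colimit C J D x \<iota>))"

text \<open>As usual, \<open>lim\<close> and \<open>colim\<close> denote a fixed but arbitrary choice of universal (co)cone.\<close>

definition lim_cone ::
  "('p, 'q) cat \<Rightarrow> ('j, 'k) cat \<Rightarrow> ('j, 'k, 'p, 'q) func \<Rightarrow> 'p \<times> ('j \<Rightarrow> 'q)" where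
  "lim_cone C J D = (SOME (x, \<pi>). is_limit C J D x \<pi>)"

abbreviation lim_obj where "lim_obj C J D \<equiv> fst (lim_cone C J D)"
abbreviation lim_proj where "lim_proj C J D \<equiv> snd (lim_cone C J D)"

definition lim_lift ::
  "('p, 'q) cat \<Rightarrow> ('j, 'k) cat \<Rightarrow> ('j, 'k, 'p, 'q) func \<Rightarrow> 'p \<Rightarrow> ('j \<Rightarrow> 'q) \<Rightarrow> 'q" where
  "lim_lift C J D y \<sigma> =
     (THE h. h \<in> hom_set C y (lim_obj C J D) \<and>
             (\<forall>j\<in>Obj J. Cmp C (lim_proj C J D j) h = \<sigma> j))"

definition colim_cocone ::
  "('p, 'q) cat \<Rightarrow> ('j, 'k) cat \<Rightarrow> ('j, 'k, 'p, 'q) func \<Rightarrow> 'p \<times> ('j \<Rightarrow> 'q)" where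
  "colim_cocone C J D = (SOME (x, \<iota>). is_colimit C J D x \<iota>)"

abbreviation colim_obj where "colim_obj C J D \<equiv> fst (colim_cocone C J D)"
abbreviation colim_inj where "colim_inj C J D \<equiv> snd (colim_cocone C J D)"

definition colim_desc ::
  "('p, 'q) cat \<Rightarrow> ('j, 'k) cat \<Rightarrow> ('j, 'k, 'p, 'q) func \<Rightarrow> 'p \<Rightarrow> ('j \<Rightarrow> 'q) \<Rightarrow> 'q" where
  "colim_desc C J D y \<sigma> =
     (THE h. h \<in> hom_set C (colim_obj C J D) y \<and>
             (\<forall>j\<in>Obj J. Cmp C h (colim_inj C J D j) = \<sigma> j))"

text \<open>A poset is a set \<open>P\<close> with a relation \<open>le\<close> such that \<open>partial_order_on P le\<close>;
  its arrows \<open>a \<rightarrow> b\<close> are the pairs \<open>(a, b) \<in> le\<close>.\<close>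

definition poset_cat :: "'p set \<Rightarrow> ('p \<times> 'p) set \<Rightarrow> ('p, 'p \<times> 'p) cat" where
  "poset_cat P le =
     \<lparr>Obj = P, Arr = le, Dom = fst, Cod = snd,
      Ide = (\<lambda>a. (a, a)), Cmp = (\<lambda>g f. (fst f, snd g))\<rparr>"

abbreviation full_subposet :: "('p \<times> 'p) set \<Rightarrow> 'p set \<Rightarrow> ('p, 'p \<times> 'p) cat" where
  "full_subposet le A \<equiv> poset_cat A (Restr le A)"

definition restrict_func ::
  "('p \<times> 'p) set \<Rightarrow> 'p set \<Rightarrow> ('p, 'p \<times> 'p, 'o, 'm) func \<Rightarrow> ('p, 'p \<times> 'p, 'o, 'm) func" where
  "restrict_func le A M =
     \<lparr>FObj = restrict (FObj M) A, FArr = restrict (FArr M) (Restr le A)\<rparr>"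

text \<open>Only the values \<open>\<rho> a b\<close> with \<open>(a, b) \<in> le\<close> are ever constrained or used.\<close>

definition height_difference ::
  "'p set \<Rightarrow> ('p \<times> 'p) set \<Rightarrow> ('p \<Rightarrow> 'p \<Rightarrow> ennreal) \<Rightarrow> bool" where
  "height_difference P le \<rho> \<longleftrightarrow>
     (\<forall>a\<in>P. \<rho> a a = 0) \<and>
     (\<forall>a b c. (a, b) \<in> le \<and> (b, c) \<in> le \<longrightarrow> \<rho> a c \<ge> \<rho> a b + \<rho> b c)"

definition down_set ::
  "'p set \<Rightarrow> ('p \<times> 'p) set \<Rightarrow> ('p \<Rightarrow> 'p \<Rightarrow> ennreal) \<Rightarrow> real \<Rightarrow> 'p \<Rightarrow> 'p set" where
  "down_set P le \<rho> r a = {x \<in> P. (x, a) \<in> le \<and> \<rho> x a \<ge> ennreal r}"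

definition up_set ::
  "'p set \<Rightarrow> ('p \<times> 'p) set \<Rightarrow> ('p \<Rightarrow> 'p \<Rightarrow> ennreal) \<Rightarrow> real \<Rightarrow> 'p \<Rightarrow> 'p set" where
  "up_set P le \<rho> r a = {x \<in> P. (a, x) \<in> le \<and> \<rho> a x \<ge> ennreal r}"

definition latching_obj ::
  "'p set \<Rightarrow> ('p \<times> 'p) set \<Rightarrow> ('p \<Rightarrow> 'p \<Rightarrow> ennreal) \<Rightarrow> ('o, 'm) cat \<Rightarrow> real \<Rightarrow>
     ('p, 'p \<times> 'p, 'o, 'm) func \<Rightarrow> ('p, 'p \<times> 'p, 'o, 'm) func" where
  "latching_obj P le \<rho> C r M =
     (let S = down_set P le \<rho> r;
          J = (\<lambda>a. full_subposet le (S a));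
          R = (\<lambda>a. restrict_func le (S a) M)
      in \<lparr>FObj = (\<lambda>a\<in>P. colim_obj C (J a) (R a)),
          FArr = (\<lambda>(a, b)\<in>le. colim_desc C (J a) (R a)
                    (colim_obj C (J b) (R b)) (colim_inj C (J b) (R b)))\<rparr>)"

definition latching ::
  "'p set \<Rightarrow> ('p \<times> 'p) set \<Rightarrow> ('p \<Rightarrow> 'p \<Rightarrow> ennreal) \<Rightarrow> ('o, 'm) cat \<Rightarrow> real \<Rightarrow>
     (('p, 'p \<times> 'p, 'o, 'm) func,
      ('p, 'p \<times> 'p, 'o, 'm) func \<times> ('p \<Rightarrow> 'm) \<times> ('p, 'p \<times> 'p, 'o, 'm) func,
      ('p, 'p \<times> 'p, 'o, 'm) func,
      ('p, 'p \<times> 'p, 'o, 'm) func \<times> ('p \<Rightarrow> 'm) \<times> ('p, 'p \<times> 'p, 'o, 'm) func) func" where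
  "latching P le \<rho> C r =
     (let S = down_set P le \<rho> r;
          J = (\<lambda>a. full_subposet le (S a));
          R = (\<lambda>M a. restrict_func le (S a) M);
          L = latching_obj P le \<rho> C r
      in \<lparr>FObj = (\<lambda>M\<in>Obj (functor_cat (poset_cat P le) C). L M),
          FArr = (\<lambda>(M, \<alpha>, N)\<in>Arr (functor_cat (poset_cat P le) C).
                    (L M,
                     \<lambda>a\<in>P. colim_desc C (J a) (R M a) (colim_obj C (J a) (R N a))
                              (\<lambda>x. Cmp C (colim_inj C (J a) (R N a) x) (\<alpha> x)),
                     L N))\<rparr>)"

definition matching_obj ::
  "'p set \<Rightarrow> ('p \<times> 'p) set \<Rightarrow> ('p \<Rightarrow> 'p \<Rightarrow> ennreal) \<Rightarrow> ('o, 'm) cat \<Rightarrow> real \<Rightarrow>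
     ('p, 'p \<times> 'p, 'o, 'm) func \<Rightarrow> ('p, 'p \<times> 'p, 'o, 'm) func" where
  "matching_obj P le \<rho> C r M =
     (let S = up_set P le \<rho> r;
          J = (\<lambda>a. full_subposet le (S a));
          R = (\<lambda>a. restrict_func le (S a) M)
      in \<lparr>FObj = (\<lambda>a\<in>P. lim_obj C (J a) (R a)),
          FArr = (\<lambda>(a, b)\<in>le. lim_lift C (J b) (R b)
                    (lim_obj C (J a) (R a)) (lim_proj C (J a) (R a)))\<rparr>)"

definition matching ::
  "'p set \<Rightarrow> ('p \<times> 'p) set \<Rightarrow> ('p \<Rightarrow> 'p \<Rightarrow> ennreal) \<Rightarrow> ('o, 'm) cat \<Rightarrow> real \<Rightarrow>
     (('p, 'p \<times> 'p, 'o, 'm) func,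
      ('p, 'p \<times> 'p, 'o, 'm) func \<times> ('p \<Rightarrow> 'm) \<times> ('p, 'p \<times> 'p, 'o, 'm) func,
      ('p, 'p \<times> 'p, 'o, 'm) func,
      ('p, 'p \<times> 'p, 'o, 'm) func \<times> ('p \<Rightarrow> 'm) \<times> ('p, 'p \<times> 'p, 'o, 'm) func) func" where
  "matching P le \<rho> C r =
     (let S = up_set P le \<rho> r;
          J = (\<lambda>a. full_subposet le (S a));
          R = (\<lambda>M a. restrict_func le (S a) M);
          U = matching_obj P le \<rho> C r
      in \<lparr>FObj = (\<lambda>M\<in>Obj (functor_cat (poset_cat P le) C). U M),
          FArr = (\<lambda>(M, \<alpha>, N)\<in>Arr (functor_cat (poset_cat P le) C).
                    (U M,
                     \<lambda>a\<in>P. lim_lift C (J a) (R N a) (lim_obj C (J a) (R M a))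
                              (\<lambda>x. Cmp C (\<alpha> x) (lim_proj C (J a) (R M a) x)),
                     U N))\<rparr>)"

end

(* Both Hom(L M, N) and Hom(M, R N) are in natural bijection with the families of arrows
   M x -> N a, indexed by the pairs x \<le> a with \<rho> x a \<ge> r, that are natural in x and in a.
   Superadditivity of \<rho> enters only through the fact that this set of pairs (called gap below) is
   closed under lowering x and raising a. *)

theory Submission
  imports Defs
begin

section \<open>Functor categories and chosen (co)limits\<close>

text \<open>The families never become a type of their own. The family of \<open>\<beta>\<close> has
  the entry \<open>\<beta> a \<cdot> coproj M a x\<close> at (x, a), the family of
  \<open>\<gamma>\<close> has the entry \<open>proj N x a \<cdot> \<gamma> x\<close>, and
  transposition passes directly from one side to the other by making these entries agree. On each
  side one of the two naturalities comes from the universal property and the other from being a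
  natural transformation; transposition exchanges the two roles. Maps out of a colimit and into a
  limit are determined by their composites with coprojections and projections, so equations between
  such maps are checked on entries. The obstacle is bookkeeping: the index category varies with the
  point, and its diagram is an extensional restriction of M. The universal properties are therefore
  restated once in terms of M itself and the single relation \<open>gap\<close>.\<close>

context category
begin

abbreviation comp (infixr "\<cdot>" 65) where "g \<cdot> f \<equiv> Cmp C g f"

lemma hom_Obj:
  assumes "f \<in> hom_set C a b"
  shows "a \<in> Obj C" "b \<in> Obj C"
  using assms Dom_in Cod_in by (auto simp: hom_set_def)

end

text \<open>Arrows carry both end functors, so an element of a hom-set amounts to its middle
  component; this form lets arrows be taken apart into triples.\<close>

lemma hom_functor_cat:
  "hom_set (functor_cat X D) F G =
     {(F, \<alpha>, G) |\<alpha>. is_functor X D F \<and> is_functor X D G \<and> is_nat_trans X D F G \<alpha>}"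
  by (auto simp: hom_set_def functor_cat_def)

lemma functor_arr:
  assumes "category X" "is_functor X D F" "f \<in> Arr X"
  shows "FArr F f \<in> hom_set D (FObj F (Dom X f)) (FObj F (Cod X f))"
    and "Dom X f \<in> Obj X" "Cod X f \<in> Obj X"
  using assms category.Dom_in category.Cod_in by (fastforce simp: is_functor_def)+

lemma is_nat_trans_Ide:
  assumes "category X" "category D" and F: "is_functor X D F"
  shows "is_nat_trans X D F F (\<lambda>a\<in>Obj X. Ide D (FObj F a))"
  unfolding is_nat_trans_def
proof (intro conjI ballI)
  fix f assume f: "f \<in> Arr X"
  show "Cmp D ((\<lambda>a\<in>Obj X. Ide D (FObj F a)) (Cod X f)) (FArr F f) =
      Cmp D (FArr F f) ((\<lambda>a\<in>Obj X. Ide D (FObj F a)) (Dom X f))"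
    using functor_arr[OF assms(1) F f] category.Cmp_Ide_right[OF assms(2)] category.Cmp_Ide_left[OF assms(2)] by simp
qed (use F category.Ide_in[OF assms(2)] in \<open>auto simp: is_functor_def\<close>)

text \<open>The naturality squares of \<open>\<alpha>\<close> and \<open>\<beta>\<close> are pasted
  along the arrow \<open>FArr G f\<close>; the three instances of associativity only move
  brackets.\<close>

lemma is_nat_trans_Cmp:
  assumes "category X" "category D"
    and F: "is_functor X D F" and G: "is_functor X D G" and H: "is_functor X D H"
    and \<alpha>: "is_nat_trans X D F G \<alpha>" and \<beta>: "is_nat_trans X D G H \<beta>"
  shows "is_nat_trans X D F H (\<lambda>a\<in>Obj X. Cmp D (\<beta> a) (\<alpha> a))"
  unfolding is_nat_trans_def
proof (intro conjI ballI)
  fix a assume "a \<in> Obj X"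
  then show "(\<lambda>a\<in>Obj X. Cmp D (\<beta> a) (\<alpha> a)) a \<in> hom_set D (FObj F a) (FObj H a)"
    using \<alpha> \<beta> by (auto simp: is_nat_trans_def intro: category.Cmp_in[OF assms(2)])
next
  fix f assume f: "f \<in> Arr X"
  note arr = functor_arr(1)[OF assms(1) _ f] and ob = functor_arr(2,3)[OF assms(1) F f]
  have h: "\<alpha> (Dom X f) \<in> hom_set D (FObj F (Dom X f)) (FObj G (Dom X f))"
    "\<alpha> (Cod X f) \<in> hom_set D (FObj F (Cod X f)) (FObj G (Cod X f))"
    "\<beta> (Dom X f) \<in> hom_set D (FObj G (Dom X f)) (FObj H (Dom X f))"
    "\<beta> (Cod X f) \<in> hom_set D (FObj G (Cod X f)) (FObj H (Cod X f))"
    using \<alpha> \<beta> ob by (auto simp: is_nat_trans_def)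
  have "Cmp D (\<alpha> (Cod X f)) (FArr F f) = Cmp D (FArr G f) (\<alpha> (Dom X f))"
    "Cmp D (\<beta> (Cod X f)) (FArr G f) = Cmp D (FArr H f) (\<beta> (Dom X f))"
    using \<alpha> \<beta> f by (auto simp: is_nat_trans_def)
  then have "Cmp D (Cmp D (\<beta> (Cod X f)) (\<alpha> (Cod X f))) (FArr F f) =
      Cmp D (FArr H f) (Cmp D (\<beta> (Dom X f)) (\<alpha> (Dom X f)))"
    using category.Cmp_assoc[OF assms(2) arr[OF F] h(2,4)] category.Cmp_assoc[OF assms(2) h(1) arr[OF G] h(4)]
      category.Cmp_assoc[OF assms(2) h(1,3) arr[OF H]] by simp
  then show "Cmp D ((\<lambda>a\<in>Obj X. Cmp D (\<beta> a) (\<alpha> a)) (Cod X f)) (FArr F f) =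
      Cmp D (FArr H f) ((\<lambda>a\<in>Obj X. Cmp D (\<beta> a) (\<alpha> a)) (Dom X f))"
    using ob by simp
qed simp

lemma category_functor_cat:
  assumes "category X" "category D"
  shows "category (functor_cat X D)"
proof
  fix F assume "F \<in> Obj (functor_cat X D)"
  then show "Ide (functor_cat X D) F \<in> hom_set (functor_cat X D) F F"
    using is_nat_trans_Ide[OF assms] by (auto simp: hom_set_def functor_cat_def)
next
  fix f g F G H
  assume "f \<in> hom_set (functor_cat X D) F G" "g \<in> hom_set (functor_cat X D) G H"
  then show "Cmp (functor_cat X D) g f \<in> hom_set (functor_cat X D) F H"
    using is_nat_trans_Cmp[OF assms] by (auto simp: hom_set_def functor_cat_def)
next
  fix f F G assume "f \<in> hom_set (functor_cat X D) F G"
  then obtain \<alpha> where f: "f = (F, \<alpha>, G)" and nt: "is_nat_trans X D F G \<alpha>"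
    by (auto simp: hom_functor_cat)
  \<comment> \<open>Off \<open>Obj X\<close> both sides are \<open>undefined\<close>: extensionality
    of \<open>\<alpha>\<close> makes the unit laws true as equations of functions.\<close>
  have "(\<lambda>a\<in>Obj X. Cmp D (\<alpha> a) ((\<lambda>a\<in>Obj X. Ide D (FObj F a)) a)) = \<alpha>"
    "(\<lambda>a\<in>Obj X. Cmp D ((\<lambda>a\<in>Obj X. Ide D (FObj G a)) a) (\<alpha> a)) = \<alpha>"
    using nt by (auto simp: is_nat_trans_def extensional_def fun_eq_iff
        intro: category.Cmp_Ide_right[OF assms(2)] category.Cmp_Ide_left[OF assms(2)])
  then show "Cmp (functor_cat X D) f (Ide (functor_cat X D) F) = f"
    "Cmp (functor_cat X D) (Ide (functor_cat X D) G) f = f"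
    by (simp_all add: f functor_cat_def)
next
  fix f g h F G H K
  assume "f \<in> hom_set (functor_cat X D) F G" "g \<in> hom_set (functor_cat X D) G H"
    "h \<in> hom_set (functor_cat X D) H K"
  then obtain \<alpha> \<beta> \<gamma> where e: "f = (F, \<alpha>, G)" "g = (G, \<beta>, H)" "h = (H, \<gamma>, K)"
    and n: "is_nat_trans X D F G \<alpha>" "is_nat_trans X D G H \<beta>" "is_nat_trans X D H K \<gamma>"
    by (auto simp: hom_functor_cat)
  have "Cmp D (\<gamma> a) (Cmp D (\<beta> a) (\<alpha> a)) = Cmp D (Cmp D (\<gamma> a) (\<beta> a)) (\<alpha> a)"
    if "a \<in> Obj X" for a
    using n that category.Cmp_assoc[OF assms(2)] unfolding is_nat_trans_def by blast
  then show "Cmp (functor_cat X D) h (Cmp (functor_cat X D) g f) =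
      Cmp (functor_cat X D) (Cmp (functor_cat X D) h g) f"
    by (auto simp: e functor_cat_def fun_eq_iff)
qed (auto simp: functor_cat_def)

section \<open>The chosen limits and colimits\<close>

lemma colim_cocone_is_colimit:
  assumes "is_colimit C J D x \<iota>"
  shows "is_colimit C J D (colim_obj C J D) (colim_inj C J D)"
  using someI[of "\<lambda>(x, \<iota>). is_colimit C J D x \<iota>" "(x, \<iota>)"] assms
  by (simp add: colim_cocone_def case_prod_beta)

lemma lim_cone_is_limit:
  assumes "is_limit C J D x \<pi>"
  shows "is_limit C J D (lim_obj C J D) (lim_proj C J D)"
  using someI[of "\<lambda>(x, \<pi>). is_limit C J D x \<pi>" "(x, \<pi>)"] assms
  by (simp add: lim_cone_def case_prod_beta)

text \<open>Unique existence gives the description in \<open>colim_desc\<close> its meaning, and it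
  is available only for cocones. Hence each later use of a descended map first needs a proof that
  its legs form a cocone.\<close>

lemma colim_desc_works:
  assumes "is_colimit C J D (colim_obj C J D) (colim_inj C J D)" "is_cocone C J D y \<sigma>"
  shows "colim_desc C J D y \<sigma> \<in> hom_set C (colim_obj C J D) y"
    "j \<in> Obj J \<Longrightarrow> Cmp C (colim_desc C J D y \<sigma>) (colim_inj C J D j) = \<sigma> j"
proof -
  have "\<exists>!h. h \<in> hom_set C (colim_obj C J D) y \<and> (\<forall>j\<in>Obj J. Cmp C h (colim_inj C J D j) = \<sigma> j)"
    using assms unfolding is_colimit_def by blast
  from theI'[OF this]
  show "colim_desc C J D y \<sigma> \<in> hom_set C (colim_obj C J D) y"
    "j \<in> Obj J \<Longrightarrow> Cmp C (colim_desc C J D y \<sigma>) (colim_inj C J D j) = \<sigma> j"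
    unfolding colim_desc_def by blast+
qed

lemma lim_lift_works:
  assumes "is_limit C J D (lim_obj C J D) (lim_proj C J D)" "is_cone C J D y \<sigma>"
  shows "lim_lift C J D y \<sigma> \<in> hom_set C y (lim_obj C J D)"
    "j \<in> Obj J \<Longrightarrow> Cmp C (lim_proj C J D j) (lim_lift C J D y \<sigma>) = \<sigma> j"
proof -
  have "\<exists>!h. h \<in> hom_set C y (lim_obj C J D) \<and> (\<forall>j\<in>Obj J. Cmp C (lim_proj C J D j) h = \<sigma> j)"
    using assms unfolding is_limit_def by blast
  from theI'[OF this]
  show "lim_lift C J D y \<sigma> \<in> hom_set C y (lim_obj C J D)"
    "j \<in> Obj J \<Longrightarrow> Cmp C (lim_proj C J D j) (lim_lift C J D y \<sigma>) = \<sigma> j"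
    unfolding lim_lift_def by blast+
qed

section \<open>Diagrams on a poset\<close>

lemma poset_cat_simps [simp]:
  "Obj (poset_cat P le) = P" "Arr (poset_cat P le) = le"
  "Dom (poset_cat P le) = fst" "Cod (poset_cat P le) = snd"
  "Ide (poset_cat P le) a = (a, a)" "Cmp (poset_cat P le) g f = (fst f, snd g)"
  by (simp_all add: poset_cat_def)

lemma category_poset_cat:
  assumes "partial_order_on P le"
  shows "category (poset_cat P le)"
proof
qed (use assms in \<open>auto simp: hom_set_def partial_order_on_def preorder_on_def refl_on_def
        dest: transD\<close>)

lemma partial_order_on_Restr:
  assumes "partial_order_on P le" "A \<subseteq> P"
  shows "partial_order_on A (Restr le A)"
  using partial_order_onD[OF assms(1)] assms(2)
  by (auto simp: partial_order_on_def preorder_on_def refl_on_def intro: trans_Restr antisym_subset)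

text \<open>A form in which arrows are explicit pairs rather than terms in \<open>fst\<close> and
  \<open>snd\<close>, so that rewriting and resolution can match them.\<close>

lemma is_functor_poset_cat:
  "is_functor (poset_cat P le) C M \<longleftrightarrow>
     FObj M \<in> extensional P \<and> FArr M \<in> extensional le \<and>
     (\<forall>a\<in>P. FObj M a \<in> Obj C) \<and>
     (\<forall>a b. (a, b) \<in> le \<longrightarrow> FArr M (a, b) \<in> hom_set C (FObj M a) (FObj M b)) \<and>
     (\<forall>a\<in>P. FArr M (a, a) = Ide C (FObj M a)) \<and>
     (\<forall>a b c. (a, b) \<in> le \<longrightarrow> (b, c) \<in> le \<longrightarrow>
        FArr M (a, c) = Cmp C (FArr M (b, c)) (FArr M (a, b)))"
proof -
  have "FArr M \<in> le \<rightarrow>\<^sub>E Arr C \<and> (\<forall>f\<in>le. FArr M f \<in> hom_set C (FObj M (fst f)) (FObj M (snd f))) \<longleftrightarrow>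
      FArr M \<in> extensional le \<and>
      (\<forall>a b. (a, b) \<in> le \<longrightarrow> FArr M (a, b) \<in> hom_set C (FObj M a) (FObj M b))"
    unfolding PiE_iff hom_set_def by auto
  moreover have "(\<forall>f\<in>le. \<forall>g\<in>le. snd f = fst g \<longrightarrow> FArr M (fst f, snd g) = Cmp C (FArr M g) (FArr M f)) \<longleftrightarrow>
    (\<forall>a b c. (a, b) \<in> le \<longrightarrow> (b, c) \<in> le \<longrightarrow>
        FArr M (a, c) = Cmp C (FArr M (b, c)) (FArr M (a, b)))"
    by force
  moreover have "FObj M \<in> P \<rightarrow>\<^sub>E Obj C \<longleftrightarrow> FObj M \<in> extensional P \<and> (\<forall>a\<in>P. FObj M a \<in> Obj C)"
    by (auto simp: PiE_iff)
  ultimately show ?thesis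
    unfolding is_functor_def poset_cat_simps by argo
qed

lemma is_nat_trans_poset_cat:
  "is_nat_trans (poset_cat P le) C M N \<alpha> \<longleftrightarrow>
     \<alpha> \<in> extensional P \<and>
     (\<forall>a\<in>P. \<alpha> a \<in> hom_set C (FObj M a) (FObj N a)) \<and>
     (\<forall>a b. (a, b) \<in> le \<longrightarrow> Cmp C (\<alpha> b) (FArr M (a, b)) = Cmp C (FArr N (a, b)) (\<alpha> a))"
  unfolding is_nat_trans_def Ball_def by simp

text \<open>By reflexivity and transitivity of \<open>le\<close> the identity and composite pairs of
  points of A lie in the restricted order again; the restricted maps are therefore not
  \<open>undefined\<close> there and inherit the equations of M.\<close>

lemma is_functor_restrict_func:
  assumes "partial_order_on P le" "is_functor (poset_cat P le) C M" "A \<subseteq> P"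
  shows "is_functor (full_subposet le A) C (restrict_func le A M)"
proof -
  have refl: "a \<in> P" "(a, a) \<in> le" if "a \<in> A" for a
    using that assms(3) partial_order_onD(1)[OF assms(1)] by (auto simp: refl_on_def)
  have trans: "(a, c) \<in> le" if "(a, b) \<in> le" "(b, c) \<in> le" for a b c
    using that partial_order_onD(2)[OF assms(1)] by (meson transD)
  note M = assms(2)[unfolded is_functor_poset_cat]
  show ?thesis
    unfolding is_functor_poset_cat
  proof (intro conjI allI impI ballI)
    fix a b c assume ab: "(a, b) \<in> Restr le A" and bc: "(b, c) \<in> Restr le A"
    then have "FArr M (a, c) = Cmp C (FArr M (b, c)) (FArr M (a, b))"
      using M by blast
    then show "FArr (restrict_func le A M) (a, c) =
        Cmp C (FArr (restrict_func le A M) (b, c)) (FArr (restrict_func le A M) (a, b))"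
      using ab bc trans[of a b c] by (simp add: restrict_func_def)
  qed (simp_all add: restrict_func_def refl M)
qed

section \<open>The pointwise universal properties\<close>

locale poset_diagrams = category C
  for C :: "('o, 'm) cat" and P :: "'p set" and le :: "('p \<times> 'p) set"
    and \<rho> :: "'p \<Rightarrow> 'p \<Rightarrow> ennreal" and r :: real +
  assumes po: "partial_order_on P le"
    and hd: "height_difference P le \<rho>"
    and complete: "complete_cat TYPE('p) TYPE('p \<times> 'p) C"
    and cocomplete: "cocomplete_cat TYPE('p) TYPE('p \<times> 'p) C"
begin

abbreviation "diagram M \<equiv> is_functor (poset_cat P le) C M"
abbreviation "nat_trans M N \<alpha> \<equiv> is_nat_trans (poset_cat P le) C M N \<alpha>"

text \<open>One relation serves both constructions: its fibre over a fixed a is the index set of the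
  colimit, its fibre over a fixed x that of the limit.\<close>

definition gap :: "('p \<times> 'p) set" where
  "gap = {(x, a) \<in> le. ennreal r \<le> \<rho> x a}"

abbreviation "down_diagram M a \<equiv> restrict_func le (down_set P le \<rho> r a) M"
abbreviation "up_diagram M x \<equiv> restrict_func le (up_set P le \<rho> r x) M"
abbreviation "down_cat a \<equiv> full_subposet le (down_set P le \<rho> r a)"
abbreviation "up_cat x \<equiv> full_subposet le (up_set P le \<rho> r x)"

text \<open>The point at which the (co)limit is formed comes first among the indices: for one pair
  (x, a) of \<open>gap\<close>, \<open>coproj M a x\<close> goes from M x to
  \<open>latch M a\<close>, while \<open>proj N x a\<close> goes from \<open>mat N x\<close> to N
  a.\<close>

definition "latch M a = colim_obj C (down_cat a) (down_diagram M a)"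
definition "coproj M a = colim_inj C (down_cat a) (down_diagram M a)"
definition "desc M a = colim_desc C (down_cat a) (down_diagram M a)"

definition "mat M x = lim_obj C (up_cat x) (up_diagram M x)"
definition "proj M x = lim_proj C (up_cat x) (up_diagram M x)"
definition "lift M x = lim_lift C (up_cat x) (up_diagram M x)"

text \<open>\<open>is_cocone\<close> with the restriction of the diagram removed. Compatibility is
  demanded for every x below a point x' of the index set, and nothing is said about
  \<open>\<sigma>\<close> outside the index set.\<close>

definition cocone :: "('p, 'p \<times> 'p, 'o, 'm) func \<Rightarrow> 'p \<Rightarrow> 'o \<Rightarrow> ('p \<Rightarrow> 'm) \<Rightarrow> bool" where
  "cocone M a y \<sigma> \<longleftrightarrow> y \<in> Obj C \<and>
     (\<forall>x. (x, a) \<in> gap \<longrightarrow> \<sigma> x \<in> hom_set C (FObj M x) y) \<and>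
     (\<forall>x x'. (x, x') \<in> le \<longrightarrow> (x', a) \<in> gap \<longrightarrow> \<sigma> x' \<cdot> FArr M (x, x') = \<sigma> x)"

definition cone :: "('p, 'p \<times> 'p, 'o, 'm) func \<Rightarrow> 'p \<Rightarrow> 'o \<Rightarrow> ('p \<Rightarrow> 'm) \<Rightarrow> bool" where
  "cone M x y \<sigma> \<longleftrightarrow> y \<in> Obj C \<and>
     (\<forall>a. (x, a) \<in> gap \<longrightarrow> \<sigma> a \<in> hom_set C y (FObj M a)) \<and>
     (\<forall>a a'. (a, a') \<in> le \<longrightarrow> (x, a) \<in> gap \<longrightarrow> FArr M (a, a') \<cdot> \<sigma> a = \<sigma> a')"

section \<open>The order, its diagrams, and the closure of \<open>gap\<close>\<close>

lemma le_P: "(x, y) \<in> le \<Longrightarrow> x \<in> P" "(x, y) \<in> le \<Longrightarrow> y \<in> P"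
  using partial_order_onD(4)[OF po] by auto

lemma le_refl: "x \<in> P \<Longrightarrow> (x, x) \<in> le"
  using partial_order_onD(1)[OF po] by (simp add: refl_on_def)

lemma le_trans: "(x, y) \<in> le \<Longrightarrow> (y, z) \<in> le \<Longrightarrow> (x, z) \<in> le"
  using partial_order_onD(2)[OF po] by (meson transD)

lemma diagram_obj: "diagram M \<Longrightarrow> a \<in> P \<Longrightarrow> FObj M a \<in> Obj C"
  by (simp add: is_functor_poset_cat)

lemma diagram_arr: "diagram M \<Longrightarrow> (a, b) \<in> le \<Longrightarrow> FArr M (a, b) \<in> hom_set C (FObj M a) (FObj M b)"
  by (simp add: is_functor_poset_cat)

lemma nat_trans_hom:
  "nat_trans M N \<alpha> \<Longrightarrow> a \<in> P \<Longrightarrow> \<alpha> a \<in> hom_set C (FObj M a) (FObj N a)"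
  by (simp add: is_nat_trans_poset_cat)

lemma nat_trans_natural:
  "nat_trans M N \<alpha> \<Longrightarrow> (a, b) \<in> le \<Longrightarrow> \<alpha> b \<cdot> FArr M (a, b) = FArr N (a, b) \<cdot> \<alpha> a"
  by (simp add: is_nat_trans_poset_cat)

lemma nat_trans_Ide: "diagram M \<Longrightarrow> nat_trans M M (\<lambda>a\<in>P. Ide C (FObj M a))"
  using is_nat_trans_Ide[OF category_poset_cat[OF po] category_axioms] by simp

lemma nat_trans_comp:
  "diagram M \<Longrightarrow> diagram N \<Longrightarrow> diagram K \<Longrightarrow> nat_trans M N \<alpha> \<Longrightarrow> nat_trans N K \<beta> \<Longrightarrow>
    nat_trans M K (\<lambda>a\<in>P. \<beta> a \<cdot> \<alpha> a)"
  using is_nat_trans_Cmp[OF category_poset_cat[OF po] category_axioms] by simp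

lemma gap_P: "(x, a) \<in> gap \<Longrightarrow> x \<in> P" "(x, a) \<in> gap \<Longrightarrow> a \<in> P"
  using le_P by (auto simp: gap_def)

text \<open>Superadditivity bounds \<open>\<rho> x a\<close> below by
  \<open>\<rho> x y + \<rho> y a\<close>, whose first summand is nonnegative.\<close>

lemma gap_down:
  assumes "(x, y) \<in> le" "(y, a) \<in> gap"
  shows "(x, a) \<in> gap"
proof -
  have "\<rho> x y + \<rho> y a \<le> \<rho> x a"
    using assms hd by (auto simp: gap_def height_difference_def)
  then have "\<rho> y a \<le> \<rho> x a"
    by (rule order_trans[rotated]) (simp add: add_increasing)
  then show ?thesis
    using assms le_trans by (auto simp: gap_def)
qed

lemma gap_up:
  assumes "(x, a) \<in> gap" "(a, b) \<in> le"
  shows "(x, b) \<in> gap"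
proof -
  have "\<rho> x a + \<rho> a b \<le> \<rho> x b"
    using assms hd by (auto simp: gap_def height_difference_def)
  then have "\<rho> x a \<le> \<rho> x b"
    by (rule order_trans[rotated]) (simp add: add_increasing2)
  then show ?thesis
    using assms le_trans by (auto simp: gap_def)
qed

lemma down_set_iff: "x \<in> down_set P le \<rho> r a \<longleftrightarrow> (x, a) \<in> gap"
  using le_P by (auto simp: down_set_def gap_def)

lemma up_set_iff: "a \<in> up_set P le \<rho> r x \<longleftrightarrow> (x, a) \<in> gap"
  using le_P by (auto simp: up_set_def gap_def)

text \<open>An arrow of the full subposet has both ends in the down-set, whereas
  \<open>cocone\<close> asks this of the target alone; \<open>gap_down\<close> supplies it for the
  source.\<close>

lemma is_cocone_iff: "is_cocone C (down_cat a) (down_diagram M a) y \<sigma> \<longleftrightarrow> cocone M a y \<sigma>"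
  by (simp add: is_cocone_def cocone_def down_set_iff restrict_func_def Ball_def cong: conj_cong imp_cong)
    (use gap_down in blast)

lemma is_cone_iff: "is_cone C (up_cat x) (up_diagram M x) y \<sigma> \<longleftrightarrow> cone M x y \<sigma>"
  by (simp add: is_cone_def cone_def up_set_iff restrict_func_def Ball_def cong: conj_cong imp_cong)
    (use gap_up in blast)

text \<open>The index category is a full subposet: its objects have type \<open>'p\<close> and its
  arrows type \<open>'p \<times> 'p\<close>, which are the types at which C is assumed
  cocomplete.\<close>

lemma latch_is_colimit:
  assumes "diagram M"
  shows "is_colimit C (down_cat a) (down_diagram M a) (latch M a) (coproj M a)"
proof -
  have "down_set P le \<rho> r a \<subseteq> P"
    by (auto simp: down_set_def)
  then have "category (down_cat a)" "is_functor (down_cat a) C (down_diagram M a)"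
    using category_poset_cat partial_order_on_Restr is_functor_restrict_func po assms by blast+
  then show ?thesis
    using cocomplete colim_cocone_is_colimit
    unfolding cocomplete_cat_def latch_def coproj_def by meson
qed

lemma mat_is_limit:
  assumes "diagram M"
  shows "is_limit C (up_cat x) (up_diagram M x) (mat M x) (proj M x)"
proof -
  have "up_set P le \<rho> r x \<subseteq> P"
    by (auto simp: up_set_def)
  then have "category (up_cat x)" "is_functor (up_cat x) C (up_diagram M x)"
    using category_poset_cat partial_order_on_Restr is_functor_restrict_func po assms by blast+
  then show ?thesis
    using complete lim_cone_is_limit
    unfolding complete_cat_def mat_def proj_def by meson
qed

lemma cocone_coproj: "diagram M \<Longrightarrow> cocone M a (latch M a) (coproj M a)"
  using latch_is_colimit by (simp add: is_colimit_def is_cocone_iff)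

lemma cone_proj: "diagram M \<Longrightarrow> cone M x (mat M x) (proj M x)"
  using mat_is_limit by (simp add: is_limit_def is_cone_iff)

lemma latch_Obj: "diagram M \<Longrightarrow> latch M a \<in> Obj C"
  using cocone_coproj by (simp add: cocone_def)

lemma mat_Obj: "diagram M \<Longrightarrow> mat M a \<in> Obj C"
  using cone_proj by (simp add: cone_def)

lemma coproj_hom: "diagram M \<Longrightarrow> (x, a) \<in> gap \<Longrightarrow> coproj M a x \<in> hom_set C (FObj M x) (latch M a)"
  using cocone_coproj by (simp add: cocone_def)

lemma proj_hom: "diagram M \<Longrightarrow> (x, a) \<in> gap \<Longrightarrow> proj M x a \<in> hom_set C (mat M x) (FObj M a)"
  using cone_proj by (simp add: cone_def)

lemma coproj_natural:
  "diagram M \<Longrightarrow> (x, x') \<in> le \<Longrightarrow> (x', a) \<in> gap \<Longrightarrow> coproj M a x' \<cdot> FArr M (x, x') = coproj M a x"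
  using cocone_coproj[of M a] by (simp add: cocone_def)

lemma proj_natural:
  "diagram M \<Longrightarrow> (a, a') \<in> le \<Longrightarrow> (x, a) \<in> gap \<Longrightarrow> FArr M (a, a') \<cdot> proj M x a = proj M x a'"
  using cone_proj[of M x] by (simp add: cone_def)

lemma
  assumes "diagram M" "cocone M a y \<sigma>"
  shows desc_hom: "desc M a y \<sigma> \<in> hom_set C (latch M a) y"
    and desc_coproj: "(x, a) \<in> gap \<Longrightarrow> desc M a y \<sigma> \<cdot> coproj M a x = \<sigma> x"
  using colim_desc_works[OF latch_is_colimit[OF assms(1), unfolded latch_def coproj_def], of a y \<sigma>] assms(2)
  by (simp_all add: desc_def latch_def coproj_def is_cocone_iff down_set_iff)

lemma
  assumes "diagram M" "cone M x y \<sigma>"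
  shows lift_hom: "lift M x y \<sigma> \<in> hom_set C y (mat M x)"
    and proj_lift: "(x, a) \<in> gap \<Longrightarrow> proj M x a \<cdot> lift M x y \<sigma> = \<sigma> a"
  using lim_lift_works[OF mat_is_limit[OF assms(1), unfolded mat_def proj_def], of x y \<sigma>] assms(2)
  by (simp_all add: lift_def mat_def proj_def is_cone_iff up_set_iff)

lemma cocone_postcomp:
  assumes "diagram M" "cocone M a y \<sigma>" "h \<in> hom_set C y z"
  shows "cocone M a z (\<lambda>x. h \<cdot> \<sigma> x)"
  unfolding cocone_def
proof (intro conjI allI impI)
  show "z \<in> Obj C"
    using assms hom_Obj by blast
  fix x assume "(x, a) \<in> gap"
  then show "h \<cdot> \<sigma> x \<in> hom_set C (FObj M x) z"
    using assms Cmp_in by (auto simp: cocone_def)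
next
  fix x x' assume "(x, x') \<in> le" "(x', a) \<in> gap"
  then show "(h \<cdot> \<sigma> x') \<cdot> FArr M (x, x') = h \<cdot> \<sigma> x"
    using assms Cmp_assoc[OF diagram_arr _ assms(3), of M x x' "\<sigma> x'"]
    by (simp add: cocone_def)
qed

lemma cone_precomp:
  assumes "diagram M" "cone M x y \<sigma>" "h \<in> hom_set C z y"
  shows "cone M x z (\<lambda>a. \<sigma> a \<cdot> h)"
  unfolding cone_def
proof (intro conjI allI impI)
  show "z \<in> Obj C"
    using assms hom_Obj by blast
  fix a assume "(x, a) \<in> gap"
  then show "\<sigma> a \<cdot> h \<in> hom_set C z (FObj M a)"
    using assms Cmp_in by (auto simp: cone_def)
next
  fix a a' assume "(a, a') \<in> le" "(x, a) \<in> gap"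
  then show "FArr M (a, a') \<cdot> (\<sigma> a \<cdot> h) = \<sigma> a' \<cdot> h"
    using assms Cmp_assoc[OF assms(3) _ diagram_arr, of "\<sigma> a" M a a']
    by (simp add: cone_def)
qed

text \<open>The coprojections are jointly epic: h and k both factor the cocone obtained by composing
  h with the coprojections. This reduces equations between arrows out of a latching object to one
  equation per pair of \<open>gap\<close>.\<close>

lemma latch_ext:
  assumes "diagram M" "h \<in> hom_set C (latch M a) y" "k \<in> hom_set C (latch M a) y"
    and "\<And>x. (x, a) \<in> gap \<Longrightarrow> h \<cdot> coproj M a x = k \<cdot> coproj M a x"
  shows "h = k"
proof -
  have "cocone M a y (\<lambda>x. h \<cdot> coproj M a x)"
    using cocone_postcomp cocone_coproj assms by blast
  then have "\<exists>!l. l \<in> hom_set C (latch M a) y \<and>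
      (\<forall>x\<in>Obj (down_cat a). l \<cdot> coproj M a x = h \<cdot> coproj M a x)"
    using latch_is_colimit[OF assms(1), of a] unfolding is_colimit_def is_cocone_iff by simp
  moreover have "\<forall>x\<in>Obj (down_cat a). k \<cdot> coproj M a x = h \<cdot> coproj M a x"
    using assms(4) by (simp add: down_set_iff)
  ultimately show ?thesis
    using assms(2,3) by blast
qed

text \<open>Dually, the projections are jointly monic.\<close>

lemma mat_ext:
  assumes "diagram M" "h \<in> hom_set C y (mat M x)" "k \<in> hom_set C y (mat M x)"
    and "\<And>a. (x, a) \<in> gap \<Longrightarrow> proj M x a \<cdot> h = proj M x a \<cdot> k"
  shows "h = k"
proof -
  have "cone M x y (\<lambda>a. proj M x a \<cdot> h)"
    using cone_precomp cone_proj assms by blast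
  then have "\<exists>!l. l \<in> hom_set C y (mat M x) \<and>
      (\<forall>a\<in>Obj (up_cat x). proj M x a \<cdot> l = proj M x a \<cdot> h)"
    using mat_is_limit[OF assms(1), of x] unfolding is_limit_def is_cone_iff by simp
  moreover have "\<forall>a\<in>Obj (up_cat x). proj M x a \<cdot> k = proj M x a \<cdot> h"
    using assms(4) by (simp add: up_set_iff)
  ultimately show ?thesis
    using assms(2,3) by blast
qed

text \<open>By \<open>gap_up\<close> the index set over a is contained in the one over b, and a
  cocone restricts along this inclusion. Applied to the coprojections at b, this yields the
  structure maps of the latching diagram.\<close>

lemma cocone_le: "cocone M b y \<sigma> \<Longrightarrow> (a, b) \<in> le \<Longrightarrow> cocone M a y \<sigma>"
  unfolding cocone_def using gap_up by blast

text \<open>The inclusion is reversed: raising x shrinks the up-set, by \<open>gap_down\<close>, so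
  a cone at x restricts to one at x'.\<close>

lemma cone_le: "cone M x y \<sigma> \<Longrightarrow> (x, x') \<in> le \<Longrightarrow> cone M x' y \<sigma>"
  unfolding cone_def using gap_down by blast

text \<open>Naturality replaces \<open>\<alpha> x' \<cdot> FArr M (x, x')\<close> by
  \<open>FArr N (x, x') \<cdot> \<alpha> x\<close>, and the cocone condition on
  \<open>\<sigma>\<close> absorbs the arrow of N. Taking the coprojections of N for
  \<open>\<sigma>\<close> makes the latching construction act on natural transformations.\<close>

lemma cocone_nat_trans:
  assumes "diagram M" "diagram N" "nat_trans M N \<alpha>" "cocone N a y \<sigma>"
  shows "cocone M a y (\<lambda>x. \<sigma> x \<cdot> \<alpha> x)"
  unfolding cocone_def
proof (intro conjI allI impI)
  show "y \<in> Obj C"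
    using assms(4) by (simp add: cocone_def)
  fix x assume "(x, a) \<in> gap"
  then show "\<sigma> x \<cdot> \<alpha> x \<in> hom_set C (FObj M x) y"
    using assms(4) Cmp_in[OF nat_trans_hom[OF assms(3)]] gap_P by (auto simp: cocone_def)
next
  fix x x' assume le: "(x, x') \<in> le" and gap: "(x', a) \<in> gap"
  have \<sigma>: "\<sigma> x' \<in> hom_set C (FObj N x') y" "\<sigma> x' \<cdot> FArr N (x, x') = \<sigma> x"
    using assms(4) le gap by (auto simp: cocone_def)
  have \<alpha>: "\<alpha> x \<in> hom_set C (FObj M x) (FObj N x)" "\<alpha> x' \<in> hom_set C (FObj M x') (FObj N x')"
    using nat_trans_hom[OF assms(3)] le_P[OF le] by auto
  show "(\<sigma> x' \<cdot> \<alpha> x') \<cdot> FArr M (x, x') = \<sigma> x \<cdot> \<alpha> x"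
    using Cmp_assoc[OF diagram_arr[OF assms(1) le] \<alpha>(2) \<sigma>(1)]
      Cmp_assoc[OF \<alpha>(1) diagram_arr[OF assms(2) le] \<sigma>(1)] nat_trans_natural[OF assms(3) le] \<sigma>(2)
    by simp
qed

lemma cone_nat_trans:
  assumes "diagram M" "diagram N" "nat_trans M N \<alpha>" "cone M x y \<sigma>"
  shows "cone N x y (\<lambda>a. \<alpha> a \<cdot> \<sigma> a)"
  unfolding cone_def
proof (intro conjI allI impI)
  show "y \<in> Obj C"
    using assms(4) by (simp add: cone_def)
  fix a assume "(x, a) \<in> gap"
  then show "\<alpha> a \<cdot> \<sigma> a \<in> hom_set C y (FObj N a)"
    using assms(4) Cmp_in[OF _ nat_trans_hom[OF assms(3)]] gap_P by (auto simp: cone_def)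
next
  fix a a' assume le: "(a, a') \<in> le" and gap: "(x, a) \<in> gap"
  have \<sigma>: "\<sigma> a \<in> hom_set C y (FObj M a)" "FArr M (a, a') \<cdot> \<sigma> a = \<sigma> a'"
    using assms(4) le gap by (auto simp: cone_def)
  have \<alpha>: "\<alpha> a \<in> hom_set C (FObj M a) (FObj N a)" "\<alpha> a' \<in> hom_set C (FObj M a') (FObj N a')"
    using nat_trans_hom[OF assms(3)] le_P[OF le] by auto
  show "FArr N (a, a') \<cdot> (\<alpha> a \<cdot> \<sigma> a) = \<alpha> a' \<cdot> \<sigma> a'"
    using Cmp_assoc[OF \<sigma>(1) \<alpha>(1) diagram_arr[OF assms(2) le]]
      Cmp_assoc[OF \<sigma>(1) diagram_arr[OF assms(1) le] \<alpha>(2)] nat_trans_natural[OF assms(3) le] \<sigma>(2)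
    by simp
qed

section \<open>The latching and matching functors\<close>

abbreviation "L \<equiv> latching_obj P le \<rho> C r"
abbreviation "R \<equiv> matching_obj P le \<rho> C r"

lemma FObj_L: "FObj (L M) = (\<lambda>a\<in>P. latch M a)"
  by (simp add: latching_obj_def Let_def latch_def)

lemma FArr_L: "FArr (L M) = (\<lambda>(a, b)\<in>le. desc M a (latch M b) (coproj M b))"
  by (simp add: latching_obj_def Let_def latch_def desc_def coproj_def)

lemma FObj_R: "FObj (R M) = (\<lambda>x\<in>P. mat M x)"
  by (simp add: matching_obj_def Let_def mat_def)

lemma FArr_R: "FArr (R M) = (\<lambda>(x, y)\<in>le. lift M y (mat M x) (proj M x))"
  by (simp add: matching_obj_def Let_def mat_def lift_def proj_def)

definition "latch_trans M N \<alpha> = (\<lambda>a\<in>P. desc M a (latch N a) (\<lambda>x. coproj N a x \<cdot> \<alpha> x))"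
definition "mat_trans M N \<alpha> = (\<lambda>x\<in>P. lift N x (mat M x) (\<lambda>a. \<alpha> a \<cdot> proj M x a))"

lemma cocone_coproj_le: "diagram M \<Longrightarrow> (a, b) \<in> le \<Longrightarrow> cocone M a (latch M b) (coproj M b)"
  using cocone_coproj cocone_le by blast

lemma cone_proj_le: "diagram M \<Longrightarrow> (x, y) \<in> le \<Longrightarrow> cone M y (mat M x) (proj M x)"
  using cone_proj cone_le by blast

text \<open>The second fact characterises the structure map, since coprojections are jointly epic;
  the functor laws are derived from it.\<close>

lemma
  assumes "diagram M" "(a, b) \<in> le"
  shows L_arr_hom: "FArr (L M) (a, b) \<in> hom_set C (latch M a) (latch M b)"
    and L_arr_coproj: "(x, a) \<in> gap \<Longrightarrow> FArr (L M) (a, b) \<cdot> coproj M a x = coproj M b x"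
  using assms by (simp_all add: FArr_L desc_hom desc_coproj cocone_coproj_le)

lemma
  assumes "diagram M" "(x, y) \<in> le"
  shows R_arr_hom: "FArr (R M) (x, y) \<in> hom_set C (mat M x) (mat M y)"
    and proj_R_arr: "(y, a) \<in> gap \<Longrightarrow> proj M y a \<cdot> FArr (R M) (x, y) = proj M x a"
  using assms by (simp_all add: FArr_R lift_hom proj_lift cone_proj_le)

text \<open>Identities and composites are recognised by their effect on coprojections: in the
  composition law both sides send \<open>coproj M a x\<close> to
  \<open>coproj M c x\<close>.\<close>

lemma diagram_L:
  assumes M: "diagram M"
  shows "diagram (L M)"
  unfolding is_functor_poset_cat
proof (intro conjI allI impI ballI)
  fix a b assume "(a, b) \<in> le"
  then show "FArr (L M) (a, b) \<in> hom_set C (FObj (L M) a) (FObj (L M) b)"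
    using L_arr_hom[OF M] le_P by (simp add: FObj_L)
next
  fix a assume a: "a \<in> P"
  show "FArr (L M) (a, a) = Ide C (FObj (L M) a)"
  proof (rule latch_ext[OF M])
    show "Ide C (FObj (L M) a) \<in> hom_set C (latch M a) (latch M a)"
      using a Ide_in latch_Obj[OF M] by (simp add: FObj_L)
    fix x assume x: "(x, a) \<in> gap"
    show "FArr (L M) (a, a) \<cdot> coproj M a x = Ide C (FObj (L M) a) \<cdot> coproj M a x"
      using a x by (simp add: L_arr_coproj M le_refl FObj_L Cmp_Ide_left[OF coproj_hom[OF M x]])
  qed (rule L_arr_hom[OF M le_refl[OF a]])
next
  fix a b c assume ab: "(a, b) \<in> le" and bc: "(b, c) \<in> le"
  note ac = le_trans[OF ab bc]
  show "FArr (L M) (a, c) = FArr (L M) (b, c) \<cdot> FArr (L M) (a, b)"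
  proof (rule latch_ext[OF M])
    show "FArr (L M) (b, c) \<cdot> FArr (L M) (a, b) \<in> hom_set C (latch M a) (latch M c)"
      using Cmp_in L_arr_hom[OF M] ab bc by blast
    fix x assume x: "(x, a) \<in> gap"
    show "FArr (L M) (a, c) \<cdot> coproj M a x = (FArr (L M) (b, c) \<cdot> FArr (L M) (a, b)) \<cdot> coproj M a x"
      \<comment> \<open>\<open>gap_up\<close> puts (x, b) into \<open>gap\<close>, so that the arrow
        from b to c can in turn be evaluated on \<open>coproj M b x\<close>.\<close>
      using Cmp_assoc[OF coproj_hom[OF M x] L_arr_hom[OF M ab] L_arr_hom[OF M bc]]
      by (simp add: L_arr_coproj[OF M] ab bc ac x gap_up[OF x ab])
  qed (rule L_arr_hom[OF M ac])
qed (auto simp: FObj_L FArr_L latch_Obj M)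

lemma diagram_R:
  assumes M: "diagram M"
  shows "diagram (R M)"
  unfolding is_functor_poset_cat
proof (intro conjI allI impI ballI)
  fix x y assume "(x, y) \<in> le"
  then show "FArr (R M) (x, y) \<in> hom_set C (FObj (R M) x) (FObj (R M) y)"
    using R_arr_hom[OF M] le_P by (simp add: FObj_R)
next
  fix x assume x: "x \<in> P"
  show "FArr (R M) (x, x) = Ide C (FObj (R M) x)"
  proof (rule mat_ext[OF M])
    show "Ide C (FObj (R M) x) \<in> hom_set C (mat M x) (mat M x)"
      using x Ide_in mat_Obj[OF M] by (simp add: FObj_R)
    fix a assume a: "(x, a) \<in> gap"
    show "proj M x a \<cdot> FArr (R M) (x, x) = proj M x a \<cdot> Ide C (FObj (R M) x)"
      using a x by (simp add: proj_R_arr M le_refl FObj_R Cmp_Ide_right[OF proj_hom[OF M a]])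
  qed (rule R_arr_hom[OF M le_refl[OF x]])
next
  fix x y z assume xy: "(x, y) \<in> le" and yz: "(y, z) \<in> le"
  note xz = le_trans[OF xy yz]
  show "FArr (R M) (x, z) = FArr (R M) (y, z) \<cdot> FArr (R M) (x, y)"
  proof (rule mat_ext[OF M])
    show "FArr (R M) (y, z) \<cdot> FArr (R M) (x, y) \<in> hom_set C (mat M x) (mat M z)"
      using Cmp_in R_arr_hom[OF M] xy yz by blast
    fix a assume a: "(z, a) \<in> gap"
    show "proj M z a \<cdot> FArr (R M) (x, z) = proj M z a \<cdot> (FArr (R M) (y, z) \<cdot> FArr (R M) (x, y))"
      \<comment> \<open>Here the intermediate projection is \<open>proj M y a\<close>, and
        \<open>gap_down\<close> shows that (y, a) indexes one.\<close>
      using Cmp_assoc[OF R_arr_hom[OF M xy] R_arr_hom[OF M yz] proj_hom[OF M a]]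
      by (simp add: proj_R_arr[OF M] xy yz xz a gap_down[OF yz a])
  qed (rule R_arr_hom[OF M xz])
qed (auto simp: FObj_R FArr_R mat_Obj M)

lemma
  assumes "diagram M" "diagram N" "nat_trans M N \<alpha>" "a \<in> P"
  shows latch_trans_hom: "latch_trans M N \<alpha> a \<in> hom_set C (latch M a) (latch N a)"
    and latch_trans_coproj:
      "(x, a) \<in> gap \<Longrightarrow> latch_trans M N \<alpha> a \<cdot> coproj M a x = coproj N a x \<cdot> \<alpha> x"
  using assms
  by (simp_all add: latch_trans_def desc_hom desc_coproj cocone_nat_trans[OF _ _ _ cocone_coproj])

lemma
  assumes "diagram M" "diagram N" "nat_trans M N \<alpha>" "x \<in> P"
  shows mat_trans_hom: "mat_trans M N \<alpha> x \<in> hom_set C (mat M x) (mat N x)"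
    and proj_mat_trans:
      "(x, a) \<in> gap \<Longrightarrow> proj N x a \<cdot> mat_trans M N \<alpha> x = \<alpha> a \<cdot> proj M x a"
  using assms
  by (simp_all add: mat_trans_def lift_hom proj_lift cone_nat_trans[OF _ _ _ cone_proj])

text \<open>Evaluated on \<open>coproj M a x\<close>, both ways around the square give
  \<open>coproj N b x \<cdot> \<alpha> x\<close>.\<close>

lemma nat_trans_latch_trans:
  assumes M: "diagram M" and N: "diagram N" and \<alpha>: "nat_trans M N \<alpha>"
  shows "nat_trans (L M) (L N) (latch_trans M N \<alpha>)"
  unfolding is_nat_trans_poset_cat
proof (intro conjI allI impI ballI)
  fix a assume "a \<in> P"
  then show "latch_trans M N \<alpha> a \<in> hom_set C (FObj (L M) a) (FObj (L N) a)"
    using latch_trans_hom[OF assms] by (simp add: FObj_L)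
next
  fix a b assume ab: "(a, b) \<in> le"
  note t = latch_trans_hom[OF assms le_P(1)[OF ab]] latch_trans_hom[OF assms le_P(2)[OF ab]]
  show "latch_trans M N \<alpha> b \<cdot> FArr (L M) (a, b) = FArr (L N) (a, b) \<cdot> latch_trans M N \<alpha> a"
  proof (rule latch_ext[OF M])
    fix x assume x: "(x, a) \<in> gap"
    show "(latch_trans M N \<alpha> b \<cdot> FArr (L M) (a, b)) \<cdot> coproj M a x =
        (FArr (L N) (a, b) \<cdot> latch_trans M N \<alpha> a) \<cdot> coproj M a x"
      using Cmp_assoc[OF coproj_hom[OF M x] L_arr_hom[OF M ab] t(2)]
        Cmp_assoc[OF coproj_hom[OF M x] t(1) L_arr_hom[OF N ab]]
        Cmp_assoc[OF nat_trans_hom[OF \<alpha> gap_P(1)[OF x]] coproj_hom[OF N x] L_arr_hom[OF N ab]]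
      by (simp add: L_arr_coproj M N ab x gap_up[OF x ab] latch_trans_coproj[OF assms] le_P[OF ab])
  qed (use Cmp_in t L_arr_hom M N ab in blast)+
qed (simp add: latch_trans_def)

text \<open>Followed by \<open>proj N y a\<close>, both ways around the square give
  \<open>\<alpha> a \<cdot> proj M x a\<close>.\<close>

lemma nat_trans_mat_trans:
  assumes M: "diagram M" and N: "diagram N" and \<alpha>: "nat_trans M N \<alpha>"
  shows "nat_trans (R M) (R N) (mat_trans M N \<alpha>)"
  unfolding is_nat_trans_poset_cat
proof (intro conjI allI impI ballI)
  fix x assume "x \<in> P"
  then show "mat_trans M N \<alpha> x \<in> hom_set C (FObj (R M) x) (FObj (R N) x)"
    using mat_trans_hom[OF assms] by (simp add: FObj_R)
next
  fix x y assume xy: "(x, y) \<in> le"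
  note t = mat_trans_hom[OF assms le_P(1)[OF xy]] mat_trans_hom[OF assms le_P(2)[OF xy]]
  show "mat_trans M N \<alpha> y \<cdot> FArr (R M) (x, y) = FArr (R N) (x, y) \<cdot> mat_trans M N \<alpha> x"
  proof (rule mat_ext[OF N])
    fix a assume a: "(y, a) \<in> gap"
    show "proj N y a \<cdot> (mat_trans M N \<alpha> y \<cdot> FArr (R M) (x, y)) =
        proj N y a \<cdot> (FArr (R N) (x, y) \<cdot> mat_trans M N \<alpha> x)"
      using Cmp_assoc[OF R_arr_hom[OF M xy] t(2) proj_hom[OF N a]]
        Cmp_assoc[OF t(1) R_arr_hom[OF N xy] proj_hom[OF N a]]
        Cmp_assoc[OF R_arr_hom[OF M xy] proj_hom[OF M a] nat_trans_hom[OF \<alpha> gap_P(2)[OF a]]]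
      by (simp add: proj_R_arr M N xy a gap_down[OF xy a] proj_mat_trans[OF assms] le_P[OF xy])
  qed (use Cmp_in t R_arr_hom M N xy in blast)+
qed (simp add: mat_trans_def)

lemma latch_trans_Ide:
  assumes M: "diagram M"
  shows "latch_trans M M (\<lambda>a\<in>P. Ide C (FObj M a)) = (\<lambda>a\<in>P. Ide C (latch M a))"
proof
  fix a
  show "latch_trans M M (\<lambda>a\<in>P. Ide C (FObj M a)) a = (\<lambda>a\<in>P. Ide C (latch M a)) a"
  \<comment> \<open>Outside P both sides are \<open>undefined\<close>; only inside P is there an
    arrow to compare.\<close>
  proof (cases "a \<in> P")
    case True
    have id: "nat_trans M M (\<lambda>a\<in>P. Ide C (FObj M a))"
      by (rule nat_trans_Ide[OF M])
    have "latch_trans M M (\<lambda>a\<in>P. Ide C (FObj M a)) a = Ide C (latch M a)"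
    proof (rule latch_ext[OF M latch_trans_hom[OF M M id True] Ide_in[OF latch_Obj[OF M]]])
      fix x assume x: "(x, a) \<in> gap"
      show "latch_trans M M (\<lambda>a\<in>P. Ide C (FObj M a)) a \<cdot> coproj M a x =
          Ide C (latch M a) \<cdot> coproj M a x"
        using gap_P(1)[OF x] Cmp_Ide_left[OF coproj_hom[OF M x]] Cmp_Ide_right[OF coproj_hom[OF M x]]
        by (simp add: latch_trans_coproj[OF M M id True x])
    qed
    then show ?thesis
      using True by simp
  qed (simp add: latch_trans_def)
qed

lemma mat_trans_Ide:
  assumes M: "diagram M"
  shows "mat_trans M M (\<lambda>a\<in>P. Ide C (FObj M a)) = (\<lambda>x\<in>P. Ide C (mat M x))"
proof
  fix x
  show "mat_trans M M (\<lambda>a\<in>P. Ide C (FObj M a)) x = (\<lambda>x\<in>P. Ide C (mat M x)) x"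
  proof (cases "x \<in> P")
    case True
    have id: "nat_trans M M (\<lambda>a\<in>P. Ide C (FObj M a))"
      by (rule nat_trans_Ide[OF M])
    have "mat_trans M M (\<lambda>a\<in>P. Ide C (FObj M a)) x = Ide C (mat M x)"
    proof (rule mat_ext[OF M mat_trans_hom[OF M M id True] Ide_in[OF mat_Obj[OF M]]])
      fix a assume a: "(x, a) \<in> gap"
      show "proj M x a \<cdot> mat_trans M M (\<lambda>a\<in>P. Ide C (FObj M a)) x =
          proj M x a \<cdot> Ide C (mat M x)"
        using gap_P(2)[OF a] Cmp_Ide_left[OF proj_hom[OF M a]] Cmp_Ide_right[OF proj_hom[OF M a]]
        by (simp add: proj_mat_trans[OF M M id True a])
    qed
    then show ?thesis
      using True by simp
  qed (simp add: mat_trans_def)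
qed

text \<open>On \<open>coproj M a x\<close> both sides give
  \<open>coproj K a x \<cdot> \<beta> x \<cdot> \<alpha> x\<close>.\<close>

lemma latch_trans_comp:
  assumes M: "diagram M" and N: "diagram N" and K: "diagram K"
    and \<alpha>: "nat_trans M N \<alpha>" and \<beta>: "nat_trans N K \<beta>"
  shows "latch_trans M K (\<lambda>a\<in>P. \<beta> a \<cdot> \<alpha> a) = (\<lambda>a\<in>P. latch_trans N K \<beta> a \<cdot> latch_trans M N \<alpha> a)"
proof
  fix a
  show "latch_trans M K (\<lambda>a\<in>P. \<beta> a \<cdot> \<alpha> a) a =
      (\<lambda>a\<in>P. latch_trans N K \<beta> a \<cdot> latch_trans M N \<alpha> a) a"
  proof (cases "a \<in> P")
    case True
    note \<beta>\<alpha> = nat_trans_comp[OF M N K \<alpha> \<beta>]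
    note t = latch_trans_hom[OF M N \<alpha> True] latch_trans_hom[OF N K \<beta> True]
    have "latch_trans M K (\<lambda>a\<in>P. \<beta> a \<cdot> \<alpha> a) a = latch_trans N K \<beta> a \<cdot> latch_trans M N \<alpha> a"
    proof (rule latch_ext[OF M latch_trans_hom[OF M K \<beta>\<alpha> True] Cmp_in[OF t]])
      fix x assume x: "(x, a) \<in> gap"
      note h = nat_trans_hom[OF \<alpha> gap_P(1)[OF x]] nat_trans_hom[OF \<beta> gap_P(1)[OF x]]
      show "latch_trans M K (\<lambda>a\<in>P. \<beta> a \<cdot> \<alpha> a) a \<cdot> coproj M a x =
          (latch_trans N K \<beta> a \<cdot> latch_trans M N \<alpha> a) \<cdot> coproj M a x"
        using Cmp_assoc[OF coproj_hom[OF M x] t] Cmp_assoc[OF h(1) coproj_hom[OF N x] t(2)]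
          Cmp_assoc[OF h coproj_hom[OF K x]] gap_P(1)[OF x]
        by (simp add: latch_trans_coproj[OF M K \<beta>\<alpha> True x] latch_trans_coproj[OF M N \<alpha> True x]
            latch_trans_coproj[OF N K \<beta> True x])
    qed
    then show ?thesis
      using True by simp
  qed (simp add: latch_trans_def)
qed

lemma mat_trans_comp:
  assumes M: "diagram M" and N: "diagram N" and K: "diagram K"
    and \<alpha>: "nat_trans M N \<alpha>" and \<beta>: "nat_trans N K \<beta>"
  shows "mat_trans M K (\<lambda>a\<in>P. \<beta> a \<cdot> \<alpha> a) = (\<lambda>x\<in>P. mat_trans N K \<beta> x \<cdot> mat_trans M N \<alpha> x)"
proof
  fix x
  show "mat_trans M K (\<lambda>a\<in>P. \<beta> a \<cdot> \<alpha> a) x =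
      (\<lambda>x\<in>P. mat_trans N K \<beta> x \<cdot> mat_trans M N \<alpha> x) x"
  proof (cases "x \<in> P")
    case True
    note \<beta>\<alpha> = nat_trans_comp[OF M N K \<alpha> \<beta>]
    note t = mat_trans_hom[OF M N \<alpha> True] mat_trans_hom[OF N K \<beta> True]
    have "mat_trans M K (\<lambda>a\<in>P. \<beta> a \<cdot> \<alpha> a) x = mat_trans N K \<beta> x \<cdot> mat_trans M N \<alpha> x"
    proof (rule mat_ext[OF K mat_trans_hom[OF M K \<beta>\<alpha> True] Cmp_in[OF t]])
      fix a assume a: "(x, a) \<in> gap"
      note h = nat_trans_hom[OF \<alpha> gap_P(2)[OF a]] nat_trans_hom[OF \<beta> gap_P(2)[OF a]]
      show "proj K x a \<cdot> mat_trans M K (\<lambda>a\<in>P. \<beta> a \<cdot> \<alpha> a) x =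
          proj K x a \<cdot> (mat_trans N K \<beta> x \<cdot> mat_trans M N \<alpha> x)"
        using Cmp_assoc[OF t proj_hom[OF K a]] Cmp_assoc[OF t(1) proj_hom[OF N a] h(2)]
          Cmp_assoc[OF proj_hom[OF M a] h] gap_P(2)[OF a]
        by (simp add: proj_mat_trans[OF M K \<beta>\<alpha> True a] proj_mat_trans[OF M N \<alpha> True a]
            proj_mat_trans[OF N K \<beta> True a])
    qed
    then show ?thesis
      using True by simp
  qed (simp add: mat_trans_def)
qed

section \<open>The two endofunctors of the functor category\<close>

abbreviation "Fun \<equiv> functor_cat (poset_cat P le) C"

lemma FObj_latching: "FObj (latching P le \<rho> C r) = (\<lambda>M\<in>Obj Fun. L M)"
  by (simp add: latching_def Let_def)

lemma FArr_latching:
  "FArr (latching P le \<rho> C r) = (\<lambda>(M, \<alpha>, N)\<in>Arr Fun. (L M, latch_trans M N \<alpha>, L N))"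
  by (simp add: latching_def Let_def latch_trans_def latch_def coproj_def desc_def)

lemma FObj_matching: "FObj (matching P le \<rho> C r) = (\<lambda>M\<in>Obj Fun. R M)"
  by (simp add: matching_def Let_def)

lemma FArr_matching:
  "FArr (matching P le \<rho> C r) = (\<lambda>(M, \<alpha>, N)\<in>Arr Fun. (R M, mat_trans M N \<alpha>, R N))"
  by (simp add: matching_def Let_def mat_trans_def mat_def proj_def lift_def)

lemma Obj_Fun: "Obj Fun = {M. diagram M}"
  and Arr_Fun: "Arr Fun = {(M, \<alpha>, N). diagram M \<and> diagram N \<and> nat_trans M N \<alpha>}"
  and Dom_Fun: "Dom Fun (M, \<alpha>, N) = M"
  and Cod_Fun: "Cod Fun (M, \<alpha>, N) = N"
  and Ide_Fun: "Ide Fun M = (M, \<lambda>a\<in>P. Ide C (FObj M a), M)"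
  and Cmp_Fun: "Cmp Fun (N', \<beta>, K) (M, \<alpha>, N) = (M, \<lambda>a\<in>P. \<beta> a \<cdot> \<alpha> a, K)"
  by (simp_all add: functor_cat_def)

lemma is_functor_latching: "is_functor Fun Fun (latching P le \<rho> C r)"
  unfolding is_functor_def
proof (intro conjI ballI impI)
  show "FObj (latching P le \<rho> C r) \<in> Obj Fun \<rightarrow>\<^sub>E Obj Fun"
    by (auto simp: FObj_latching Obj_Fun diagram_L)
  show "FArr (latching P le \<rho> C r) \<in> Arr Fun \<rightarrow>\<^sub>E Arr Fun"
    by (auto simp: FArr_latching Arr_Fun diagram_L nat_trans_latch_trans)
next
  fix f assume "f \<in> Arr Fun"
  then show "FArr (latching P le \<rho> C r) f \<in> hom_set Fun
      (FObj (latching P le \<rho> C r) (Dom Fun f)) (FObj (latching P le \<rho> C r) (Cod Fun f))"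
    by (auto simp: FArr_latching FObj_latching Arr_Fun Obj_Fun hom_set_def Dom_Fun Cod_Fun
        diagram_L nat_trans_latch_trans)
next
  fix M assume "M \<in> Obj Fun"
  then show "FArr (latching P le \<rho> C r) (Ide Fun M) = Ide Fun (FObj (latching P le \<rho> C r) M)"
    by (auto simp: FArr_latching FObj_latching Arr_Fun Obj_Fun Ide_Fun nat_trans_Ide latch_trans_Ide
        FObj_L fun_eq_iff)
next
  fix f g assume "f \<in> Arr Fun" "g \<in> Arr Fun" "Cod Fun f = Dom Fun g"
  then show "FArr (latching P le \<rho> C r) (Cmp Fun g f) =
      Cmp Fun (FArr (latching P le \<rho> C r) g) (FArr (latching P le \<rho> C r) f)"
    by (auto simp: FArr_latching Arr_Fun Dom_Fun Cod_Fun Cmp_Fun nat_trans_comp latch_trans_comp)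
qed

lemma is_functor_matching: "is_functor Fun Fun (matching P le \<rho> C r)"
  unfolding is_functor_def
proof (intro conjI ballI impI)
  show "FObj (matching P le \<rho> C r) \<in> Obj Fun \<rightarrow>\<^sub>E Obj Fun"
    by (auto simp: FObj_matching Obj_Fun diagram_R)
  show "FArr (matching P le \<rho> C r) \<in> Arr Fun \<rightarrow>\<^sub>E Arr Fun"
    by (auto simp: FArr_matching Arr_Fun diagram_R nat_trans_mat_trans)
next
  fix f assume "f \<in> Arr Fun"
  then show "FArr (matching P le \<rho> C r) f \<in> hom_set Fun
      (FObj (matching P le \<rho> C r) (Dom Fun f)) (FObj (matching P le \<rho> C r) (Cod Fun f))"
    by (auto simp: FArr_matching FObj_matching Arr_Fun Obj_Fun hom_set_def Dom_Fun Cod_Fun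
        diagram_R nat_trans_mat_trans)
next
  fix M assume "M \<in> Obj Fun"
  then show "FArr (matching P le \<rho> C r) (Ide Fun M) = Ide Fun (FObj (matching P le \<rho> C r) M)"
    by (auto simp: FArr_matching FObj_matching Arr_Fun Obj_Fun Ide_Fun nat_trans_Ide mat_trans_Ide
        FObj_R fun_eq_iff)
next
  fix f g assume "f \<in> Arr Fun" "g \<in> Arr Fun" "Cod Fun f = Dom Fun g"
  then show "FArr (matching P le \<rho> C r) (Cmp Fun g f) =
      Cmp Fun (FArr (matching P le \<rho> C r) g) (FArr (matching P le \<rho> C r) f)"
    by (auto simp: FArr_matching Arr_Fun Dom_Fun Cod_Fun Cmp_Fun nat_trans_comp mat_trans_comp)
qed

section \<open>The adjunction\<close>

text \<open>The entries of a family are regrouped: \<open>\<beta>\<close> holds, for each a, the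
  cocone of entries in x, and here the entries for a fixed x are collected into a cone in a.
  \<open>left_transpose\<close> regroups the other way.\<close>

definition "right_transpose M N \<beta> = (\<lambda>x\<in>P. lift N x (FObj M x) (\<lambda>a. \<beta> a \<cdot> coproj M a x))"
definition "left_transpose M N \<gamma> = (\<lambda>a\<in>P. desc M a (FObj N a) (\<lambda>x. proj N x a \<cdot> \<gamma> x))"

lemma hom_from_L:
  "nat_trans (L M) N \<beta> \<Longrightarrow> a \<in> P \<Longrightarrow> \<beta> a \<in> hom_set C (latch M a) (FObj N a)"
  using nat_trans_hom by (fastforce simp: FObj_L)

lemma hom_to_R:
  "nat_trans M (R N) \<gamma> \<Longrightarrow> x \<in> P \<Longrightarrow> \<gamma> x \<in> hom_set C (FObj M x) (mat N x)"
  using nat_trans_hom by (fastforce simp: FObj_R)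

text \<open>Compatibility in a is naturality of \<open>\<beta>\<close>, because the structure map of
  L M from a to b carries \<open>coproj M a x\<close> to \<open>coproj M b x\<close>.\<close>

lemma cone_right_transpose:
  assumes M: "diagram M" and N: "diagram N" and \<beta>: "nat_trans (L M) N \<beta>" and x: "x \<in> P"
  shows "cone N x (FObj M x) (\<lambda>a. \<beta> a \<cdot> coproj M a x)"
  unfolding cone_def
proof (intro conjI allI impI)
  fix a assume a: "(x, a) \<in> gap"
  show "\<beta> a \<cdot> coproj M a x \<in> hom_set C (FObj M x) (FObj N a)"
    using Cmp_in[OF coproj_hom[OF M a] hom_from_L[OF \<beta> gap_P(2)[OF a]]] .
next
  fix a b assume ab: "(a, b) \<in> le" and a: "(x, a) \<in> gap"
  note h = hom_from_L[OF \<beta> le_P(1)[OF ab]] hom_from_L[OF \<beta> le_P(2)[OF ab]]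
  show "FArr N (a, b) \<cdot> (\<beta> a \<cdot> coproj M a x) = \<beta> b \<cdot> coproj M b x"
    using Cmp_assoc[OF coproj_hom[OF M a] h(1) diagram_arr[OF N ab]]
      Cmp_assoc[OF coproj_hom[OF M a] L_arr_hom[OF M ab] h(2)]
    by (simp add: L_arr_coproj[OF M ab a] nat_trans_natural[OF \<beta> ab])
qed (rule diagram_obj[OF M x])

text \<open>Compatibility in x is naturality of \<open>\<gamma>\<close>, because
  \<open>proj N y a\<close> after the structure map of R N from x to y is
  \<open>proj N x a\<close>.\<close>

lemma cocone_left_transpose:
  assumes M: "diagram M" and N: "diagram N" and \<gamma>: "nat_trans M (R N) \<gamma>" and a: "a \<in> P"
  shows "cocone M a (FObj N a) (\<lambda>x. proj N x a \<cdot> \<gamma> x)"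
  unfolding cocone_def
proof (intro conjI allI impI)
  fix x assume x: "(x, a) \<in> gap"
  show "proj N x a \<cdot> \<gamma> x \<in> hom_set C (FObj M x) (FObj N a)"
    using Cmp_in[OF hom_to_R[OF \<gamma> gap_P(1)[OF x]] proj_hom[OF N x]] .
next
  fix x y assume xy: "(x, y) \<in> le" and y: "(y, a) \<in> gap"
  note h = hom_to_R[OF \<gamma> le_P(1)[OF xy]] hom_to_R[OF \<gamma> le_P(2)[OF xy]]
  show "(proj N y a \<cdot> \<gamma> y) \<cdot> FArr M (x, y) = proj N x a \<cdot> \<gamma> x"
    using Cmp_assoc[OF diagram_arr[OF M xy] h(2) proj_hom[OF N y]]
      Cmp_assoc[OF h(1) R_arr_hom[OF N xy] proj_hom[OF N y]]
    by (simp add: proj_R_arr[OF N xy y] nat_trans_natural[OF \<gamma> xy])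
qed (rule diagram_obj[OF N a])

lemma
  assumes "diagram M" "diagram N" "nat_trans (L M) N \<beta>" "x \<in> P"
  shows right_transpose_hom: "right_transpose M N \<beta> x \<in> hom_set C (FObj M x) (mat N x)"
    and proj_right_transpose: "(x, a) \<in> gap \<Longrightarrow> proj N x a \<cdot> right_transpose M N \<beta> x = \<beta> a \<cdot> coproj M a x"
  using assms by (simp_all add: right_transpose_def lift_hom proj_lift cone_right_transpose)

lemma
  assumes "diagram M" "diagram N" "nat_trans M (R N) \<gamma>" "a \<in> P"
  shows left_transpose_hom: "left_transpose M N \<gamma> a \<in> hom_set C (latch M a) (FObj N a)"
    and left_transpose_coproj:
      "(x, a) \<in> gap \<Longrightarrow> left_transpose M N \<gamma> a \<cdot> coproj M a x = proj N x a \<cdot> \<gamma> x"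
  using assms by (simp_all add: left_transpose_def desc_hom desc_coproj cocone_left_transpose)

text \<open>Naturality in x comes from the cocone condition on the coprojections of M: after
  \<open>proj N y a\<close>, both sides equal \<open>\<beta> a \<cdot> coproj M a x\<close>.\<close>

lemma nat_trans_right_transpose:
  assumes M: "diagram M" and N: "diagram N" and \<beta>: "nat_trans (L M) N \<beta>"
  shows "nat_trans M (R N) (right_transpose M N \<beta>)"
  unfolding is_nat_trans_poset_cat
proof (intro conjI allI impI ballI)
  fix x assume "x \<in> P"
  then show "right_transpose M N \<beta> x \<in> hom_set C (FObj M x) (FObj (R N) x)"
    using right_transpose_hom[OF assms] by (simp add: FObj_R)
next
  fix x y assume xy: "(x, y) \<in> le"
  note t = right_transpose_hom[OF assms le_P(1)[OF xy]] right_transpose_hom[OF assms le_P(2)[OF xy]]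
  show "right_transpose M N \<beta> y \<cdot> FArr M (x, y) = FArr (R N) (x, y) \<cdot> right_transpose M N \<beta> x"
  proof (rule mat_ext[OF N Cmp_in[OF diagram_arr[OF M xy] t(2)] Cmp_in[OF t(1) R_arr_hom[OF N xy]]])
    fix a assume a: "(y, a) \<in> gap"
    show "proj N y a \<cdot> (right_transpose M N \<beta> y \<cdot> FArr M (x, y)) =
        proj N y a \<cdot> (FArr (R N) (x, y) \<cdot> right_transpose M N \<beta> x)"
      using Cmp_assoc[OF diagram_arr[OF M xy] t(2) proj_hom[OF N a]]
        Cmp_assoc[OF t(1) R_arr_hom[OF N xy] proj_hom[OF N a]]
        Cmp_assoc[OF diagram_arr[OF M xy] coproj_hom[OF M a] hom_from_L[OF \<beta> gap_P(2)[OF a]]]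
      by (simp add: proj_R_arr[OF N xy a] proj_right_transpose[OF assms] le_P[OF xy] a gap_down[OF xy a]
          coproj_natural[OF M xy a])
  qed
qed (simp add: right_transpose_def)

text \<open>Here naturality in a comes from the cone condition on the projections of N: on
  \<open>coproj M a x\<close>, both sides equal
  \<open>proj N x b \<cdot> \<gamma> x\<close>.\<close>

lemma nat_trans_left_transpose:
  assumes M: "diagram M" and N: "diagram N" and \<gamma>: "nat_trans M (R N) \<gamma>"
  shows "nat_trans (L M) N (left_transpose M N \<gamma>)"
  unfolding is_nat_trans_poset_cat
proof (intro conjI allI impI ballI)
  fix a assume "a \<in> P"
  then show "left_transpose M N \<gamma> a \<in> hom_set C (FObj (L M) a) (FObj N a)"
    using left_transpose_hom[OF assms] by (simp add: FObj_L)
next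
  fix a b assume ab: "(a, b) \<in> le"
  note t = left_transpose_hom[OF assms le_P(1)[OF ab]] left_transpose_hom[OF assms le_P(2)[OF ab]]
  show "left_transpose M N \<gamma> b \<cdot> FArr (L M) (a, b) = FArr N (a, b) \<cdot> left_transpose M N \<gamma> a"
  proof (rule latch_ext[OF M Cmp_in[OF L_arr_hom[OF M ab] t(2)] Cmp_in[OF t(1) diagram_arr[OF N ab]]])
    fix x assume x: "(x, a) \<in> gap"
    show "(left_transpose M N \<gamma> b \<cdot> FArr (L M) (a, b)) \<cdot> coproj M a x =
        (FArr N (a, b) \<cdot> left_transpose M N \<gamma> a) \<cdot> coproj M a x"
      using Cmp_assoc[OF coproj_hom[OF M x] L_arr_hom[OF M ab] t(2)]
        Cmp_assoc[OF coproj_hom[OF M x] t(1) diagram_arr[OF N ab]]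
        Cmp_assoc[OF hom_to_R[OF \<gamma> gap_P(1)[OF x]] proj_hom[OF N x] diagram_arr[OF N ab]]
      by (simp add: L_arr_coproj[OF M ab x] left_transpose_coproj[OF assms] le_P[OF ab] x gap_up[OF x ab]
          proj_natural[OF N ab x])
  qed
qed (simp add: left_transpose_def)

text \<open>Each transposition preserves the entries, and \<open>\<beta> a\<close> is determined by
  its entries because the coprojections at a are jointly epic.\<close>

lemma left_transpose_right_transpose:
  assumes M: "diagram M" and N: "diagram N" and \<beta>: "nat_trans (L M) N \<beta>"
  shows "left_transpose M N (right_transpose M N \<beta>) = \<beta>"
proof (rule extensionalityI[of _ P])
  show "left_transpose M N (right_transpose M N \<beta>) \<in> extensional P" "\<beta> \<in> extensional P"
    using \<beta> by (simp_all add: left_transpose_def is_nat_trans_poset_cat)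
  note \<gamma> = nat_trans_right_transpose[OF assms]
  fix a assume a: "a \<in> P"
  show "left_transpose M N (right_transpose M N \<beta>) a = \<beta> a"
    by (rule latch_ext[OF M left_transpose_hom[OF M N \<gamma> a] hom_from_L[OF \<beta> a]])
      (simp add: left_transpose_coproj[OF M N \<gamma> a] proj_right_transpose[OF assms] gap_P)
qed

lemma right_transpose_left_transpose:
  assumes M: "diagram M" and N: "diagram N" and \<gamma>: "nat_trans M (R N) \<gamma>"
  shows "right_transpose M N (left_transpose M N \<gamma>) = \<gamma>"
proof (rule extensionalityI[of _ P])
  show "right_transpose M N (left_transpose M N \<gamma>) \<in> extensional P" "\<gamma> \<in> extensional P"
    using \<gamma> by (simp_all add: right_transpose_def is_nat_trans_poset_cat)
  note \<beta> = nat_trans_left_transpose[OF assms]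
  fix x assume x: "x \<in> P"
  show "right_transpose M N (left_transpose M N \<gamma>) x = \<gamma> x"
    by (rule mat_ext[OF N right_transpose_hom[OF M N \<beta> x] hom_to_R[OF \<gamma> x]])
      (simp add: proj_right_transpose[OF M N \<beta> x] left_transpose_coproj[OF assms] gap_P)
qed

text \<open>At (x, a) both sides have the entry \<open>\<delta> a \<cdot> (\<beta> a \<cdot> coproj
  M a x) \<cdot> \<alpha> x\<close>. The nested restrictions are those that two applications of
  \<open>Cmp_Fun\<close> produce.\<close>

lemma right_transpose_natural:
  assumes M: "diagram M" and M': "diagram M'" and N: "diagram N" and N': "diagram N'"
    and \<alpha>: "nat_trans M' M \<alpha>" and \<beta>: "nat_trans (L M) N \<beta>" and \<delta>: "nat_trans N N' \<delta>"
  shows "right_transpose M' N' (\<lambda>a\<in>P. \<delta> a \<cdot> (\<lambda>a\<in>P. \<beta> a \<cdot> latch_trans M' M \<alpha> a) a) =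
    (\<lambda>x\<in>P. mat_trans N N' \<delta> x \<cdot> (\<lambda>x\<in>P. right_transpose M N \<beta> x \<cdot> \<alpha> x) x)" (is "right_transpose M' N' ?\<epsilon> = ?R")
proof (rule extensionalityI[of _ P])
  show "right_transpose M' N' ?\<epsilon> \<in> extensional P" "?R \<in> extensional P"
    by (simp_all add: right_transpose_def)
  have \<epsilon>: "nat_trans (L M') N' ?\<epsilon>"
    by (intro nat_trans_comp[OF _ _ _ _ \<delta>] nat_trans_comp[OF _ _ _ _ \<beta>] nat_trans_latch_trans
        diagram_L assms)
  fix x assume x: "x \<in> P"
  note t = right_transpose_hom[OF M N \<beta> x] mat_trans_hom[OF N N' \<delta> x] nat_trans_hom[OF \<alpha> x]
  have "right_transpose M' N' ?\<epsilon> x = mat_trans N N' \<delta> x \<cdot> (right_transpose M N \<beta> x \<cdot> \<alpha> x)"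
  proof (rule mat_ext[OF N' right_transpose_hom[OF M' N' \<epsilon> x] Cmp_in[OF Cmp_in[OF t(3,1)] t(2)]])
    fix a assume xa: "(x, a) \<in> gap"
    note a = gap_P(2)[OF xa]
    note h = latch_trans_hom[OF M' M \<alpha> a] hom_from_L[OF \<beta> a] nat_trans_hom[OF \<delta> a]
    have "proj N' x a \<cdot> right_transpose M' N' ?\<epsilon> x = (\<delta> a \<cdot> (\<beta> a \<cdot> latch_trans M' M \<alpha> a)) \<cdot> coproj M' a x"
      using a proj_right_transpose[OF M' N' \<epsilon> x xa] by simp
    also have "\<dots> = \<delta> a \<cdot> (\<beta> a \<cdot> (latch_trans M' M \<alpha> a \<cdot> coproj M' a x))"
      using Cmp_assoc[OF coproj_hom[OF M' xa] Cmp_in[OF h(1,2)] h(3)]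
        Cmp_assoc[OF coproj_hom[OF M' xa] h(1,2)] by simp
    \<comment> \<open>Here \<open>\<alpha>\<close> moves from its component at a, through the
      latching objects, to its component at x.\<close>
    also have "\<dots> = \<delta> a \<cdot> ((\<beta> a \<cdot> coproj M a x) \<cdot> \<alpha> x)"
      using Cmp_assoc[OF t(3) coproj_hom[OF M xa] h(2)]
      by (simp add: latch_trans_coproj[OF M' M \<alpha> a xa])
    also have "\<dots> = \<delta> a \<cdot> (proj N x a \<cdot> (right_transpose M N \<beta> x \<cdot> \<alpha> x))"
      using Cmp_assoc[OF t(3,1) proj_hom[OF N xa]] by (simp add: proj_right_transpose[OF M N \<beta> x xa])
    also have "\<dots> = proj N' x a \<cdot> (mat_trans N N' \<delta> x \<cdot> (right_transpose M N \<beta> x \<cdot> \<alpha> x))"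
      using Cmp_assoc[OF Cmp_in[OF t(3,1)] proj_hom[OF N xa] h(3)]
        Cmp_assoc[OF Cmp_in[OF t(3,1)] t(2) proj_hom[OF N' xa]]
      by (simp add: proj_mat_trans[OF N N' \<delta> x xa])
    finally show "proj N' x a \<cdot> right_transpose M' N' ?\<epsilon> x =
        proj N' x a \<cdot> (mat_trans N N' \<delta> x \<cdot> (right_transpose M N \<beta> x \<cdot> \<alpha> x))" .
  qed
  then show "right_transpose M' N' ?\<epsilon> x = ?R x"
    using x by simp
qed

theorem latching_matching_adjoint:
  "left_adjoint Fun Fun (latching P le \<rho> C r) (matching P le \<rho> C r)"
  unfolding left_adjoint_def
\<comment> \<open>An arrow of \<open>Fun\<close> stores its ends, so the bijection must also replace
  the ends L M and N by M and R N; only the middle component is transposed.\<close>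
proof (intro conjI exI[of _ "\<lambda>M N (_, \<beta>, _). (M, right_transpose M N \<beta>, R N)"] ballI)
  show "category Fun" "category Fun"
    by (intro category_functor_cat category_poset_cat po category_axioms)+
  show "is_functor Fun Fun (latching P le \<rho> C r)" "is_functor Fun Fun (matching P le \<rho> C r)"
    by (rule is_functor_latching is_functor_matching)+
next
  fix M N assume "M \<in> Obj Fun" "N \<in> Obj Fun"
  then have MN: "diagram M" "diagram N"
    by (simp_all add: Obj_Fun)
  show "bij_betw (\<lambda>(_, \<beta>, _). (M, right_transpose M N \<beta>, R N))
      (hom_set Fun (FObj (latching P le \<rho> C r) M) N) (hom_set Fun M (FObj (matching P le \<rho> C r) N))"
    \<comment> \<open>The inverse restores the ends L M and N along with transposing back.\<close>
    by (rule bij_betw_byWitness[where f' = "\<lambda>(_, \<gamma>, _). (L M, left_transpose M N \<gamma>, N)"])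
      (use MN in \<open>auto simp: FObj_latching FObj_matching Obj_Fun hom_functor_cat diagram_L diagram_R
        left_transpose_right_transpose right_transpose_left_transpose nat_trans_right_transpose nat_trans_left_transpose\<close>)
next
  fix M M' N N' f g h
  assume "M \<in> Obj Fun" "M' \<in> Obj Fun" "N \<in> Obj Fun" "N' \<in> Obj Fun"
    and "f \<in> hom_set Fun M' M" "g \<in> hom_set Fun N N'"
    and "h \<in> hom_set Fun (FObj (latching P le \<rho> C r) M) N"
  then obtain \<alpha> \<beta> \<delta> where eqs: "f = (M', \<alpha>, M)" "g = (N, \<delta>, N')" "h = (L M, \<beta>, N)"
    and D: "diagram M" "diagram M'" "diagram N" "diagram N'"
    and T: "nat_trans M' M \<alpha>" "nat_trans (L M) N \<beta>" "nat_trans N N' \<delta>"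
    by (auto simp: FObj_latching Obj_Fun hom_functor_cat)
  have "FArr (latching P le \<rho> C r) f = (L M', latch_trans M' M \<alpha>, L M)"
    "FArr (matching P le \<rho> C r) g = (R N, mat_trans N N' \<delta>, R N')"
    using eqs D T by (simp_all add: FArr_latching FArr_matching Arr_Fun)
  then show "(\<lambda>(_, \<beta>, _). (M', right_transpose M' N' \<beta>, R N'))
        (Cmp Fun g (Cmp Fun h (FArr (latching P le \<rho> C r) f))) =
      Cmp Fun (FArr (matching P le \<rho> C r) g)
        (Cmp Fun ((\<lambda>(_, \<beta>, _). (M, right_transpose M N \<beta>, R N)) h) f)"
    \<comment> \<open>\<open>restrict_apply\<close> is disabled so that the nested restrictions keep
      the shape in which \<open>right_transpose_natural\<close> states them.\<close>
    using right_transpose_natural[OF D T] by (simp add: eqs Cmp_Fun del: restrict_apply)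
qed

end

theorem proposition3p5:
  fixes P :: "'p set" and le :: "('p \<times> 'p) set"
    and \<rho> :: "'p \<Rightarrow> 'p \<Rightarrow> ennreal"
    and C :: "('o, 'm) cat"
    and r :: real
  assumes "partial_order_on P le"
    and "height_difference P le \<rho>"
    and "category C"
    and "complete_cat TYPE('p) TYPE('p \<times> 'p) C"
    and "cocomplete_cat TYPE('p) TYPE('p \<times> 'p) C"
    and "0 \<le> r"
  shows "left_adjoint (functor_cat (poset_cat P le) C) (functor_cat (poset_cat P le) C)
           (latching P le \<rho> C r) (matching P le \<rho> C r)"
proof -
  interpret poset_diagrams C P le \<rho> r
    using assms by (simp add: poset_diagrams_def poset_diagrams_axioms_def)
  show ?thesis
    by (rule latching_matching_adjoint)
qed

end
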